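(* Let $\alpha,\lambda\in(0,\infty)$ and $\beta\in(0,1)$, and let $X\sim\mathrm{TS}(\alpha,\beta,\lambda)$ be a one-sided tempered stable process. Let $N$ be the random measure associated to the jumps of $X$, let $\varphi_\beta:[0,\infty)\to(0,\infty)$ be given by $\varphi_\beta(x)=(1+\beta x)^{-1/\beta}$, and define the random variables $$Y_n:=N\big((0,1]\times(\varphi_\beta(n+1),\varphi_\beta(n)]\big),\quad n\in\mathbb{N}.$$ Then almost surely $$\frac1n\sum_{j=1}^nY_j\to\alpha\quad\text{as }n\to\infty.$$
   Context: For $\alpha,\lambda\in(0,\infty)$ and $\beta\in[0,1)$, the one-sided tempered stable distribution $\mathrm{TS}(\alpha,\beta,\lambda)$ is the infinitely divisible distribution on $\mathbb{R}$ with characteristic function $\varphi(z)=\exp\big(\int_{\mathbb{R}}(e^{izx}-1)F(dx)\big)$, $z\in\mathbb{R}$, where $F(dx)=\frac{\alpha}{x^{1+\beta}}e^{-\lambda x}\mathbf{1}_{(0,\infty)}(x)\,dx$. A one-sided tempered stable process $X\sim\mathrm{TS}(\alpha,\beta,\lambda)$ is a (càdlàg) Lévy process such that $X_1$ has this distribution. The random measure of jumps is $N(A)=\#\{t>0:\Delta X_t\ne0,\ (t,\Delta X_t)\in A\}$ for Borel sets $A\subset(0,\infty)\times\mathbb{R}$, where $\Delta X_t=X_t-X_{t-}$; it is a homogeneous Poisson random measure with compensator $dt\otimes F(dx)$. *)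

theory Defs
  imports "HOL-Probability.Probability"
begin

section \<open>Levy processes\<close>

definition cadlag :: "(real \<Rightarrow> real) \<Rightarrow> bool" where
  "cadlag x \<longleftrightarrow>
     (\<forall>t\<ge>0. (x \<longlongrightarrow> x t) (at_right t)) \<and>
     (\<forall>t>0. \<exists>l. (x \<longlongrightarrow> l) (at_left t))"

text \<open>
  The time set is the half-line of nonnegative reals: values of the process at negative times
  are never constrained or used.  Stochastic continuity is not listed separately, since it
  follows from stationarity of the increments and right-continuity at time 0.
\<close>

locale levy_process = prob_space M for M :: "'a measure" +
  fixes X :: "real \<Rightarrow> 'a \<Rightarrow> real"
  assumes measurable_X: "\<And>t. 0 \<le> t \<Longrightarrow> X t \<in> borel_measurable M"
    and X_0: "AE \<omega> in M. X 0 \<omega> = 0"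
    and indep_increments:
      "\<And>(n::nat) (t :: nat \<Rightarrow> real). 0 \<le> t 0 \<Longrightarrow> (\<And>i. i < n \<Longrightarrow> t i \<le> t (Suc i)) \<Longrightarrow>
         indep_vars (\<lambda>_. borel) (\<lambda>i \<omega>. X (t (Suc i)) \<omega> - X (t i) \<omega>) {..<n}"
    and stationary_increments:
      "\<And>s t. 0 \<le> s \<Longrightarrow> s \<le> t \<Longrightarrow>
         distr M borel (\<lambda>\<omega>. X t \<omega> - X s \<omega>) = distr M borel (X (t - s))"
    and cadlag_paths: "AE \<omega> in M. cadlag (\<lambda>t. X t \<omega>)"

section \<open>Jumps\<close>

definition jump :: "(real \<Rightarrow> real) \<Rightarrow> real \<Rightarrow> real" where
  "jump x t = x t - Lim (at_left t) x"

text \<open>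
  The number of jumps lying in a set of (time, size) pairs.  Counting is done with the counting
  measure rather than with \<^const>\<open>card\<close>, so that infinitely many jumps count as infinity.
\<close>

definition jump_measure :: "(real \<Rightarrow> 'a \<Rightarrow> real) \<Rightarrow> (real \<times> real) set \<Rightarrow> 'a \<Rightarrow> ennreal" where
  "jump_measure X A \<omega> =
     emeasure (count_space UNIV)
       {t. 0 < t \<and> jump (\<lambda>s. X s \<omega>) t \<noteq> 0 \<and> (t, jump (\<lambda>s. X s \<omega>) t) \<in> A}"

section \<open>One-sided tempered stable distributions and processes\<close>

definition infinitely_divisible :: "real measure \<Rightarrow> bool" where
  "infinitely_divisible \<mu> \<longleftrightarrow>
     (\<forall>n::nat. 0 < n \<longrightarrow>
        (\<exists>\<nu>. real_distribution \<nu> \<and>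
             \<mu> = distr (PiM {..<n} (\<lambda>_. \<nu>)) borel (\<lambda>x. \<Sum>i<n. x i)))"

definition TS_levy_measure :: "real \<Rightarrow> real \<Rightarrow> real \<Rightarrow> real measure" where
  "TS_levy_measure \<alpha> \<beta> lam =
     density lborel
       (\<lambda>x. ennreal (\<alpha> / x powr (1 + \<beta>) * exp (- lam * x) * indicator {0<..} x))"

definition TS_distribution :: "real \<Rightarrow> real \<Rightarrow> real \<Rightarrow> real measure \<Rightarrow> bool" where
  "TS_distribution \<alpha> \<beta> lam \<mu> \<longleftrightarrow>
     real_distribution \<mu> \<and> infinitely_divisible \<mu> \<and>
     (\<forall>z. char \<mu> z = exp (CLINT x | TS_levy_measure \<alpha> \<beta> lam. (iexp (z * x) - 1)))"

locale TS_process = levy_process M X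
  for M :: "'a measure" and X :: "real \<Rightarrow> 'a \<Rightarrow> real" +
  fixes \<alpha> \<beta> lam :: real
  assumes distr_X_1: "TS_distribution \<alpha> \<beta> lam (distr M borel (X 1))"

definition phi :: "real \<Rightarrow> real \<Rightarrow> real" where
  "phi \<beta> x = (1 + \<beta> * x) powr (- 1 / \<beta>)"

end

theory Submission
  imports Defs "HOL-Real_Asymp.Real_Asymp"
begin

text \<open>
  Since \<open>Y 1 + \<dots> + Y n\<close> telescopes, up to finitely many jumps it is the number of jumps in \<open>(0,1]\<close>
  larger than \<open>phi \<beta> (n + 1)\<close>, and neither independence nor the Poisson law of the \<open>Y j\<close> is needed:
  large deviation bounds for this single count are summable in \<open>n\<close>, so Borel-Cantelli applies.

  For a cadlag path the number of jumps exceeding \<open>u\<close> is squeezed between the eventual numbers of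
  increments over the grid \<open>i / N\<close> exceeding \<open>u\<close>, respectively a slightly larger \<open>v\<close>.  For fixed \<open>N\<close>
  that number is binomial with success probability \<open>P(X (1/N) > u)\<close>, so Chernoff's bound reduces
  everything to \<open>N P(X (1/N) > u) \<longlonglongrightarrow> F (u, \<infinity>)\<close>.  The latter follows from
  \<open>char (X (1/N)) = exp (\<psi> / N)\<close> and Levy's continuity theorem, and
  \<open>F (phi \<beta> k, \<infinity>) = \<alpha> k + O(1)\<close> by comparing the density with \<open>\<alpha> / x powr (1 + \<beta>)\<close>.
\<close>

section \<open>Counting the jumps of a cadlag path on a grid\<close>

definition jumps_above :: "(real \<Rightarrow> real) \<Rightarrow> real \<Rightarrow> real set" where
  "jumps_above x u = {t \<in> {0<..1}. u < jump x t}"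

definition grid_increments_above :: "(real \<Rightarrow> real) \<Rightarrow> nat \<Rightarrow> real \<Rightarrow> nat set" where
  "grid_increments_above x n u =
     {i \<in> {..<n}. u < x (real (Suc i) / real n) - x (real i / real n)}"

lemma cadlag_left_limit:
  assumes "cadlag x" "0 < t"
  shows "(x \<longlongrightarrow> x t - jump x t) (at_left t)"
proof -
  obtain l where "(x \<longlongrightarrow> l) (at_left t)"
    using assms unfolding cadlag_def by blast
  moreover from this have "Lim (at_left t) x = l"
    by (intro tendsto_Lim) simp_all
  ultimately show ?thesis by (simp add: jump_def)
qed

text \<open>Taken within the closed half-line because grid points approaching t from the right may
  equal t; continuity within \<open>{t..}\<close> composes with such sequences.\<close>

lemma cadlag_right_limit:
  assumes "cadlag x" "0 \<le> t"
  shows "(x \<longlongrightarrow> x t) (at t within {t..})"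
proof -
  have "(x \<longlongrightarrow> x t) (at_right t)"
    using assms unfolding cadlag_def by blast
  moreover have "at t within {t..} = at_right t"
    by (rule at_within_nhd[of _ UNIV]) auto
  ultimately show ?thesis by simp
qed

lemma LIMSEQ_grid_right: "(\<lambda>n. of_int \<lceil>real n * t\<rceil> / real n) \<longlonglongrightarrow> t"
proof (rule tendsto_sandwich)
  show "\<forall>\<^sub>F n in sequentially. t \<le> of_int \<lceil>real n * t\<rceil> / real n"
    using eventually_gt_at_top[of 0]
    by eventually_elim (simp add: field_simps)
  show "\<forall>\<^sub>F n in sequentially. of_int \<lceil>real n * t\<rceil> / real n \<le> t + 1 / real n"
    using eventually_gt_at_top[of 0]
    by eventually_elim (simp add: field_simps, linarith)
  show "(\<lambda>n. t + 1 / real n) \<longlonglongrightarrow> t"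
    by real_asymp
qed auto

text \<open>The ceiling selects the half-open grid cell containing t: its right end is at least t,
  where right-continuity applies, and its left end is strictly below t, where the left limit
  applies.\<close>

lemma grid_increment_tendsto_jump:
  assumes "cadlag x" "0 < t"
  shows "(\<lambda>n. x (of_int \<lceil>real n * t\<rceil> / real n) - x (of_int (\<lceil>real n * t\<rceil> - 1) / real n))
           \<longlonglongrightarrow> jump x t"
proof -
  let ?r = "\<lambda>n. of_int \<lceil>real n * t\<rceil> / real n"
  let ?l = "\<lambda>n. of_int (\<lceil>real n * t\<rceil> - 1) / real n"
  have r: "?r \<longlonglongrightarrow> t" by (rule LIMSEQ_grid_right)
  have "(\<lambda>n. ?r n - 1 / real n) \<longlonglongrightarrow> t - 0"
    by (intro tendsto_diff r lim_1_over_n)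
  then have l: "?l \<longlonglongrightarrow> t" by (simp add: diff_divide_distrib)
  have "filterlim ?l (at_left t) sequentially"
  proof (rule filterlim_at_withinI[OF l])
    show "\<forall>\<^sub>F n in sequentially. ?l n \<in> {..<t} - {t}"
      using eventually_gt_at_top[of 0]
      by eventually_elim (simp add: field_simps, linarith)
  qed
  then have 1: "(\<lambda>n. x (?l n)) \<longlonglongrightarrow> x t - jump x t"
    by (rule filterlim_compose[OF cadlag_left_limit[OF assms]])
  have "\<forall>\<^sub>F n in sequentially. ?r n \<in> {t..}"
    using eventually_gt_at_top[of 0]
    by eventually_elim (simp add: field_simps)
  then have 2: "(\<lambda>n. x (?r n)) \<longlonglongrightarrow> x t"
    using assms r cadlag_right_limit[of x t]
    by (intro continuous_within_tendsto_compose[where S="{t..}" and f=x and a=t]) (simp_all add: continuous_within)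
  show ?thesis using tendsto_diff[OF 2 1] by simp
qed

text \<open>Once the mesh is finer than the gaps in T, its points lie in different cells, and the
  increment over each such cell is close to a jump exceeding u, so the strict inequality persists. A
  finite T stands in for the set of all jumps because finiteness of that set is later deduced from
  this bound.\<close>

lemma card_le_grid_increments_above:
  assumes x: "cadlag x" and T: "finite T" "T \<subseteq> jumps_above x u"
  shows "\<forall>\<^sub>F n in sequentially. card T \<le> card (grid_increments_above x n u)"
proof -
  have T': "0 < t" "t \<le> 1" "u < jump x t" if "t \<in> T" for t
    using T that by (auto simp: jumps_above_def)
  have "\<forall>\<^sub>F n in sequentially. \<forall>t\<in>T.
      u < x (of_int \<lceil>real n * t\<rceil> / real n) - x (of_int (\<lceil>real n * t\<rceil> - 1) / real n)"
    using T T' by (intro eventually_ball_finite ballI order_tendstoD[OF grid_increment_tendsto_jump] x) auto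
  moreover have "\<forall>\<^sub>F n in sequentially. \<forall>s\<in>T. \<forall>t\<in>T. s < t \<longrightarrow> \<lceil>real n * s\<rceil> < \<lceil>real n * t\<rceil>"
  proof (intro eventually_ball_finite ballI T)
    fix s t assume "s \<in> T" "t \<in> T"
    show "\<forall>\<^sub>F n in sequentially. s < t \<longrightarrow> \<lceil>real n * s\<rceil> < \<lceil>real n * t\<rceil>"
    proof (cases "s < t")
      case True
      have "\<forall>\<^sub>F n in sequentially. real n * (t - s) > 1"
        using True by real_asymp
      then show ?thesis
        by eventually_elim (simp add: algebra_simps, linarith)
    qed simp
  qed
  ultimately show ?thesis
    using eventually_gt_at_top[of 0]
  proof eventually_elim
    case (elim n)
    \<comment> \<open>The cell (i/n, (i+1)/n] containing t has i = ceiling(n t) - 1; here 0 < t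
      keeps \<open>nat\<close> from truncating, and t <= 1 gives i < n.\<close>
    let ?i = "\<lambda>t. nat (\<lceil>real n * t\<rceil> - 1)"
    have pos: "\<lceil>real n * t\<rceil> \<ge> 1" if "t \<in> T" for t
      using T'[OF that] elim(3) by (simp add: le_ceiling_iff)
    have "inj_on ?i T"
    proof (rule linorder_inj_onI)
      fix s t assume "s < t" "s \<in> T" "t \<in> T"
      then show "?i s \<noteq> ?i t"
        using elim(2)[rule_format, of s t] pos[of s] pos[of t] by linarith
    qed auto
    moreover have "?i ` T \<subseteq> grid_increments_above x n u"
    proof (rule image_subsetI)
      fix t assume t: "t \<in> T"
      have "real n * t \<le> real n" using T'[OF t] by (simp add: mult_left_le)
      then have "\<lceil>real n * t\<rceil> \<le> int n" by (simp add: ceiling_le_iff)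
      then have "?i t < n"
        using pos[OF t] by linarith
      have *: "real (?i t) = of_int (\<lceil>real n * t\<rceil> - 1)" "real (Suc (?i t)) = of_int \<lceil>real n * t\<rceil>"
        using pos[OF t] by simp_all
      show "?i t \<in> grid_increments_above x n u"
        using elim(1)[rule_format, OF t] \<open>?i t < n\<close> unfolding grid_increments_above_def mem_Collect_eq * by simp
    qed
    ultimately show ?case
      by (intro card_inj_on_le[of ?i]) (auto simp: grid_increments_above_def)
  qed
qed

text \<open>Near \<tau> the path stays within e of x(\<tau>) on the right and within e of the left
  limit on the left. With e = (v - u)/2, an increment above v >= 2e must therefore straddle \<tau>,
  and the jump there exceeds v - 2e = u.\<close>

lemma cadlag_large_increment_imp_jump_local:
  assumes x: "cadlag x" and u: "0 \<le> u" "u < v" and \<tau>: "0 \<le> \<tau>"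
  obtains d where "0 < d" "\<And>s t. 0 \<le> s \<Longrightarrow> s < t \<Longrightarrow> s \<in> ball \<tau> d \<Longrightarrow> t \<in> ball \<tau> d \<Longrightarrow> v < x t - x s \<Longrightarrow>
      \<exists>r. s < r \<and> r \<le> t \<and> u < jump x r"
proof -
  define e where "e = (v - u) / 2"
  have e: "0 < e" "u + 2 * e = v" using u by (auto simp: e_def field_simps)
  obtain d1 where d1: "0 < d1" "\<And>s. \<tau> \<le> s \<Longrightarrow> dist s \<tau> < d1 \<Longrightarrow> \<bar>x s - x \<tau>\<bar> < e"
  proof -
    have "\<exists>d>0. \<forall>s\<in>{\<tau>..}. 0 < dist s \<tau> \<and> dist s \<tau> < d \<longrightarrow> dist (x s) (x \<tau>) < e"
      using cadlag_right_limit[OF x \<tau>] e unfolding Lim_within by blast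
    then obtain d where d: "d > 0" "\<forall>s\<in>{\<tau>..}. 0 < dist s \<tau> \<and> dist s \<tau> < d \<longrightarrow> dist (x s) (x \<tau>) < e"
      by blast
    show thesis
    proof (rule that[OF d(1)])
      fix s assume "\<tau> \<le> s" "dist s \<tau> < d"
      then show "\<bar>x s - x \<tau>\<bar> < e" using d(2) e(1) by (cases "s = \<tau>") (auto simp: dist_real_def)
    qed
  qed
  obtain d2 where d2: "0 < d2"
    "\<And>s. 0 \<le> s \<Longrightarrow> s < \<tau> \<Longrightarrow> dist s \<tau> < d2 \<Longrightarrow> \<bar>x s - (x \<tau> - jump x \<tau>)\<bar> < e"
  proof (cases "\<tau> = 0")
    case True
    then show thesis using that[of 1] by auto
  next
    case False
    then have "0 < \<tau>" using \<tau> by simp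
    then have "\<exists>d>0. \<forall>s\<in>{..<\<tau>}. 0 < dist s \<tau> \<and> dist s \<tau> < d \<longrightarrow> dist (x s) (x \<tau> - jump x \<tau>) < e"
      using cadlag_left_limit[OF x] e unfolding Lim_within by blast
    then show thesis using that by (auto simp: dist_real_def)
  qed
  show thesis
  proof (rule that[of "min d1 d2"])
    fix s t assume st: "0 \<le> s" "s < t" "s \<in> ball \<tau> (min d1 d2)" "t \<in> ball \<tau> (min d1 d2)" "v < x t - x s"
    then have d: "dist s \<tau> < d1" "dist s \<tau> < d2" "dist t \<tau> < d1" "dist t \<tau> < d2"
      by (auto simp: dist_commute)
    consider "\<tau> \<le> s" | "t < \<tau>" | "s < \<tau>" "\<tau> \<le> t" by linarith
    then show "\<exists>r. s < r \<and> r \<le> t \<and> u < jump x r"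
    proof cases
      case 1
      then show ?thesis using d1(2)[of s] d1(2)[of t] d st e u by linarith
    next
      case 2
      then show ?thesis using d2(2)[of s] d2(2)[of t] d st e u by linarith
    next
      case 3
      then have "u < jump x \<tau>" using d2(2)[of s] d1(2)[of t] d st e u by linarith
      then show ?thesis using 3 by blast
    qed
  qed (use d1 d2 in auto)
qed

text \<open>Compactness makes the local statement uniform: once the mesh is below a Lebesgue number
  of a suitable cover of [0,1], each grid increment above v forces a jump above u inside its cell.
  The gap between u and v absorbs the oscillation of the path, and \<open>fin\<close> prevents the
  cardinality on the right from degenerating to 0.\<close>

lemma grid_increments_above_le_card:
  assumes x: "cadlag x" and u: "0 \<le> u" "u < v" and fin: "finite (jumps_above x u)"
  shows "\<forall>\<^sub>F n in sequentially. card (grid_increments_above x n v) \<le> card (jumps_above x u)"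
proof -
  \<comment> \<open>The jump time is sought in the half-open interval (s, t], so that adjacent grid
    cells never share it; this makes \<open>r\<close> below injective.\<close>
  define good where "good B \<longleftrightarrow> (\<forall>s\<in>B. \<forall>t\<in>B. 0 \<le> s \<longrightarrow> s < t \<longrightarrow> v < x t - x s \<longrightarrow>
      (\<exists>r. s < r \<and> r \<le> t \<and> u < jump x r))" for B
  have loc: "\<exists>d>0. good (ball \<tau> d)" if "0 \<le> \<tau>" for \<tau>
    by (rule cadlag_large_increment_imp_jump_local[OF x u that]) (unfold good_def, blast)
  obtain \<delta> where \<delta>: "0 < \<delta>" "\<And>T. T \<subseteq> {0..1} \<Longrightarrow> diameter T < \<delta> \<Longrightarrow> \<exists>B\<in>{B. open B \<and> good B}. T \<subseteq> B"
  proof (rule Lebesgue_number_lemma[of "{0..1::real}" "{B. open B \<and> good B}"])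
    show "{0..1} \<subseteq> \<Union> {B. open B \<and> good B}"
    proof
      fix \<tau> :: real assume "\<tau> \<in> {0..1}"
      then obtain d where "d > 0" "good (ball \<tau> d)" using loc by auto
      then show "\<tau> \<in> \<Union> {B. open B \<and> good B}" by (intro UnionI[of "ball \<tau> d"]) auto
    qed
    show "{B. open B \<and> good B} \<noteq> {}" using loc[of 0] by auto
  qed auto
  have "\<forall>\<^sub>F n in sequentially. 1 / real n < \<delta>"
    using \<delta>(1) by real_asymp
  then show ?thesis
    using eventually_gt_at_top[of 0]
  proof eventually_elim
    case (elim n)
    have ex: "\<exists>r. real i / real n < r \<and> r \<le> real (Suc i) / real n \<and> u < jump x r"
      if i: "i \<in> grid_increments_above x n v" for i
    proof -
      let ?s = "real i / real n" and ?t = "real (Suc i) / real n"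
      have i': "i < n" "v < x ?t - x ?s" using i by (auto simp: grid_increments_above_def)
      have "0 \<le> ?s" "?s < ?t" "?t \<le> 1" using elim(2) i' by (auto simp: field_simps)
      moreover have "?t - ?s = 1 / real n" by (simp add: diff_divide_distrib[symmetric])
      ultimately have "\<exists>B\<in>{B. open B \<and> good B}. {?s..?t} \<subseteq> B"
        using elim(1) \<open>?s < ?t\<close> by (intro \<delta>(2)) (simp_all add: diameter_closed_interval)
      then obtain B where B: "good B" "{?s..?t} \<subseteq> B" by blast
      then have "?s \<in> B" "?t \<in> B" using \<open>?s < ?t\<close> by auto
      then show ?thesis using B i' \<open>?s < ?t\<close> unfolding good_def by auto
    qed
    define r where "r i = (SOME r. real i / real n < r \<and> r \<le> real (Suc i) / real n \<and> u < jump x r)" for i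
    have r: "real i / real n < r i \<and> r i \<le> real (Suc i) / real n \<and> u < jump x (r i)"
      if "i \<in> grid_increments_above x n v" for i
      unfolding r_def by (rule someI_ex[OF ex[OF that]])
    have "inj_on r (grid_increments_above x n v)"
    proof (rule linorder_inj_onI)
      fix i j assume ij: "i < j" "i \<in> grid_increments_above x n v" "j \<in> grid_increments_above x n v"
      have "real (Suc i) / real n \<le> real j / real n"
        using ij by (intro divide_right_mono) auto
      then show "r i \<noteq> r j" using r[OF ij(2)] r[OF ij(3)] by linarith
    qed auto
    moreover have "r ` grid_increments_above x n v \<subseteq> jumps_above x u"
    proof (rule image_subsetI)
      fix i assume i: "i \<in> grid_increments_above x n v"
      then have "real (Suc i) / real n \<le> 1" "0 \<le> real i / real n"
        using elim(2) by (auto simp: grid_increments_above_def)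
      then have "0 < r i" "r i \<le> 1" using r[OF i] by linarith+
      then show "r i \<in> jumps_above x u" using r[OF i] by (simp add: jumps_above_def)
    qed
    ultimately show ?case using fin by (intro card_inj_on_le)
  qed
qed

section \<open>Small-time tail asymptotics\<close>

text \<open>Mean value inequality on the convex half-plane Re <= 0, where the derivative of exp has
  norm at most 1.\<close>

lemma norm_exp_minus_one_le:
  fixes w :: complex
  assumes "Re w \<le> 0"
  shows "norm (exp w - 1) \<le> norm w"
proof -
  have "norm (exp w - exp 0) \<le> 1 * norm (w - 0)"
    by (rule field_differentiable_bound[of "{z. Re z \<le> 0}" exp exp])
       (use assms in \<open>auto intro!: derivative_eq_intros convex_halfspace_Re_le\<close>)
  then show ?thesis by simp
qed

text \<open>This is the difference quotient of z -> exp(z w) at 0, taken along z = 1/n.\<close>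

lemma LIMSEQ_of_nat_mult_exp_minus_one:
  fixes w :: complex
  shows "(\<lambda>n. of_nat n * (exp (w / of_nat n) - 1)) \<longlonglongrightarrow> w"
proof -
  have "((\<lambda>z. (exp (z * w) - 1) / z) \<longlongrightarrow> w) (at 0)"
    using DERIV_cmult_right[OF DERIV_exp] 
    by (auto intro!: derivative_eq_intros simp: DERIV_def[of "\<lambda>z. exp (z * w)" w 0, simplified, symmetric])
  moreover have "filterlim (\<lambda>n. 1 / of_nat n :: complex) (at 0) sequentially"
    using lim_1_over_n eventually_gt_at_top[of 0] by (auto simp: filterlim_at elim!: eventually_mono)
  ultimately have "(\<lambda>n. (exp (1 / of_nat n * w) - 1) / (1 / of_nat n)) \<longlonglongrightarrow> w"
    by (rule filterlim_compose)
  then show ?thesis by (simp add: mult.commute)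
qed

section \<open>Gaussian weighting of Levy measures\<close>

definition gauss_weight :: "real \<Rightarrow> real" where
  "gauss_weight x = 1 - exp (- (x\<^sup>2) / 2)"

lemma gauss_weight_nonneg: "0 \<le> gauss_weight x"
  by (simp add: gauss_weight_def)

lemma gauss_weight_mono: "0 \<le> x \<Longrightarrow> x \<le> y \<Longrightarrow> gauss_weight x \<le> gauss_weight y"
  by (simp add: gauss_weight_def power_mono)

lemma gauss_weight_pos: "x \<noteq> 0 \<Longrightarrow> 0 < gauss_weight x"
  by (simp add: gauss_weight_def)

lemma measurable_gauss_weight [measurable]: "gauss_weight \<in> borel_measurable borel"
  unfolding gauss_weight_def by measurable

lemma isCont_gauss_weight: "isCont gauss_weight x"
  unfolding gauss_weight_def by (intro continuous_intros) simp

text \<open>Averaging iexp((z + g) x) over a standard normal g multiplies iexp(z x) by exp(-x^2/2),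
  the normal characteristic function; by Fubini, subtracting the average leaves exactly the factor
  \<open>gauss_weight\<close>. A general sigma-finite F lets the identity serve both the Levy
  measure, which may be infinite, and the probability laws.\<close>

lemma gaussian_average_char:
  fixes F :: "real measure"
  assumes sf: "sigma_finite_measure F" and sets [measurable_cong]: "sets F = sets borel"
    and int: "integrable F (\<lambda>x. iexp (z * x) - 1)"
    and int2: "integrable (std_normal_distribution \<Otimes>\<^sub>M F) (\<lambda>(g, x). iexp ((z + g) * x) - 1)"
  shows "integrable F (\<lambda>x. gauss_weight x *\<^sub>R iexp (z * x))"
    and "(CLINT x|F. iexp (z * x) - 1) - (CLINT g|std_normal_distribution. CLINT x|F. iexp ((z + g) * x) - 1)
           = (CLINT x|F. gauss_weight x *\<^sub>R iexp (z * x))"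
proof -
  interpret N: real_distribution std_normal_distribution by (rule real_dist_normal_dist)
  interpret F: sigma_finite_measure F by fact
  interpret P: pair_sigma_finite std_normal_distribution F by standard
  have inner: "(CLINT g|std_normal_distribution. iexp ((z + g) * x) - 1) = exp (- (x\<^sup>2) / 2) *\<^sub>R iexp (z * x) - 1"
    for x
  proof -
    have "integrable std_normal_distribution (\<lambda>g. iexp (g * x))"
      by (rule N.integrable_iexp) auto
    moreover have "(CLINT g|std_normal_distribution. iexp (g * x)) = exp (- (x\<^sup>2) / 2)"
      using fun_cong[OF char_std_normal_distribution, of x] by (simp add: char_def mult.commute)
    ultimately show ?thesis
      using N.prob_space by (simp add: ring_distribs exp_add scaleR_conv_of_real)
  qed
  have int3: "integrable F (\<lambda>x. exp (- (x\<^sup>2) / 2) *\<^sub>R iexp (z * x) - 1)"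
    using P.integrable_snd[OF int2] by (simp only: inner prod.case)
  have eq: "gauss_weight x *\<^sub>R iexp (z * x) = (iexp (z * x) - 1) - (exp (- (x\<^sup>2) / 2) *\<^sub>R iexp (z * x) - 1)"
    for x by (simp add: gauss_weight_def scaleR_diff_left)
  show "integrable F (\<lambda>x. gauss_weight x *\<^sub>R iexp (z * x))"
    unfolding eq by (intro Bochner_Integration.integrable_diff int int3)
  have "(CLINT g|std_normal_distribution. CLINT x|F. iexp ((z + g) * x) - 1)
      = (CLINT x|F. exp (- (x\<^sup>2) / 2) *\<^sub>R iexp (z * x) - 1)"
    using P.Fubini_integral[OF int2] by (simp only: inner)
  then show "(CLINT x|F. iexp (z * x) - 1) - (CLINT g|std_normal_distribution. CLINT x|F. iexp ((z + g) * x) - 1)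
           = (CLINT x|F. gauss_weight x *\<^sub>R iexp (z * x))"
    by (simp only: eq Bochner_Integration.integral_diff[OF int int3])
qed

text \<open>When the weight has a positive finite integral this is a probability measure, even if F
  has infinite mass near 0, so Levy's continuity theorem becomes applicable.\<close>

definition gauss_tilt :: "real measure \<Rightarrow> real measure" where
  "gauss_tilt F = density F (\<lambda>x. ennreal (gauss_weight x / (\<integral>x. gauss_weight x \<partial>F)))"

text \<open>The last claim undoes the tilt: for x > u >= 0 the weight is positive, so dividing by it
  recovers the tail mass of F up to the normalising constant.\<close>

lemma
  fixes F :: "real measure"
  assumes sets [measurable_cong]: "sets F = sets borel"
    and int: "integrable F gauss_weight" and pos: "0 < (\<integral>x. gauss_weight x \<partial>F)"
  shows real_distribution_gauss_tilt: "real_distribution (gauss_tilt F)"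
    and char_gauss_tilt: "char (gauss_tilt F) z =
      (CLINT x|F. gauss_weight x *\<^sub>R iexp (z * x)) / of_real (\<integral>x. gauss_weight x \<partial>F)"
    and integral_tail_gauss_tilt: "0 \<le> u \<Longrightarrow>
      (\<integral>x. indicator {u<..} x / gauss_weight x \<partial>gauss_tilt F) = measure F {u<..} / (\<integral>x. gauss_weight x \<partial>F)"
proof -
  let ?c = "\<integral>x. gauss_weight x \<partial>F"
  note gauss_weight_nonneg[simp]
  have "emeasure (gauss_tilt F) (space F) = (\<integral>\<^sup>+x. ennreal (gauss_weight x / ?c) \<partial>F)"
    unfolding gauss_tilt_def by (subst emeasure_density) (auto intro!: nn_integral_cong)
  also have "\<dots> = ennreal (\<integral>x. gauss_weight x / ?c \<partial>F)"
    using int pos by (intro nn_integral_eq_integral) auto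
  also have "\<dots> = 1" using pos by simp
  finally have "prob_space (gauss_tilt F)"
    by (intro prob_spaceI) (simp add: gauss_tilt_def)
  then show "real_distribution (gauss_tilt F)"
    by (simp add: real_distribution_def real_distribution_axioms_def gauss_tilt_def sets)
  have "char (gauss_tilt F) z = (CLINT x|F. (gauss_weight x / ?c) *\<^sub>R iexp (z * x))"
    unfolding char_def gauss_tilt_def using pos by (intro integral_density) auto
  also have "\<dots> = (CLINT x|F. (gauss_weight x *\<^sub>R iexp (z * x)) / of_real ?c)"
    by (simp add: scaleR_conv_of_real)
  finally show "char (gauss_tilt F) z = (CLINT x|F. gauss_weight x *\<^sub>R iexp (z * x)) / of_real ?c"
    by simp
  assume u: "0 \<le> u"
  have "(\<integral>x. indicator {u<..} x / gauss_weight x \<partial>gauss_tilt F)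
      = (\<integral>x. (gauss_weight x / ?c) *\<^sub>R (indicator {u<..} x / gauss_weight x) \<partial>F)"
    unfolding gauss_tilt_def using pos by (intro integral_density) auto
  also have "\<dots> = (\<integral>x. indicator {u<..} x / ?c \<partial>F)"
  proof (rule Bochner_Integration.integral_cong)
    fix x show "(gauss_weight x / ?c) *\<^sub>R (indicator {u<..} x / gauss_weight x) = indicator {u<..} x / ?c"
      using u gauss_weight_pos[of x] by (auto simp: indicator_def)
  qed simp
  also have "\<dots> = measure F {u<..} / ?c"
    using sets_eq_imp_space_eq[OF sets] by simp
  finally show "(\<integral>x. indicator {u<..} x / gauss_weight x \<partial>gauss_tilt F) = measure F {u<..} / ?c" .
qed

lemma norm_iexp_minus_one_le: "norm (iexp x - 1) \<le> \<bar>x\<bar>"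
  using iexp_approx1[of x 0] by simp

lemma norm_iexp_minus_one_le_2: "norm (iexp x - 1) \<le> 2"
  using iexp_approx2[of x 0] by simp

text \<open>
  No integrability or positivity of \<open>\<mu> n\<close> is available, so the measures \<open>n \<mu> n\<close> are compared with
  \<open>F\<close> after weighting both with \<^const>\<open>gauss_weight\<close>: the Fourier transform of the weighted
  measure is obtained by subtracting a Gaussian average of the exponent.
\<close>
theorem tail_tendsto_levy_measure:
  fixes F :: "real measure" and \<mu> :: "nat \<Rightarrow> real measure" and u :: real
  assumes sf: "sigma_finite_measure F" and sets [measurable_cong]: "sets F = sets borel"
    and int: "integrable F (\<lambda>x. x)"
    and u: "0 < u" "emeasure F {u} = 0"
    and \<mu>: "\<And>n. 0 < n \<Longrightarrow> real_distribution (\<mu> n)"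
    and char_\<mu>: "\<And>n z. 0 < n \<Longrightarrow> char (\<mu> n) z = exp ((CLINT x|F. iexp (z * x) - 1) / of_nat n)"
  shows "(\<lambda>n. real n * measure (\<mu> n) {u<..}) \<longlonglongrightarrow> measure F {u<..}"
proof -
  let ?N = std_normal_distribution
  interpret N: real_distribution ?N by (rule real_dist_normal_dist)
  interpret F: sigma_finite_measure F by fact
  interpret P: pair_sigma_finite ?N F by standard
  have [simp]: "space F = UNIV" using sets_eq_imp_space_eq[OF sets] by simp
  define \<psi> where "\<psi> z = (CLINT x|F. iexp (z * x) - 1)" for z
  define K where "K = (\<integral>x. \<bar>x\<bar> \<partial>F)"
  have K: "0 \<le> K" by (simp add: K_def)
  have int_F: "integrable F (\<lambda>x. iexp (z * x) - 1)" for z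
    by (rule Bochner_Integration.integrable_bound[of _ "\<lambda>x. z * x"])
       (use int norm_iexp_minus_one_le[of "z * _"] in auto)
  \<comment> \<open>Linear growth, with the first absolute moment of F as constant, is integrable
    under the normal law and so provides the dominating functions below.\<close>
  have bound: "norm (\<psi> z) \<le> K * \<bar>z\<bar>" for z
  proof -
    have "norm (\<psi> z) \<le> (\<integral>x. \<bar>x\<bar> * \<bar>z\<bar> \<partial>F)"
      unfolding \<psi>_def
      using int integrable_norm[OF int_F[of z]] norm_iexp_minus_one_le[of "z * _"]
      by (intro order_trans[OF integral_norm_bound integral_mono]) (auto simp: abs_mult mult.commute)
    then show ?thesis using int by (simp add: K_def)
  qed
  \<comment> \<open>Since \<open>\<mu> 1\<close> is a probability law, the norm exp(Re
    (\<open>\<psi> z\<close>)) of its characteristic function is at most 1.\<close>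
  have Re_\<psi>: "Re (\<psi> z) \<le> 0" for z
  proof -
    interpret real_distribution "\<mu> 1" by (rule \<mu>) simp
    show ?thesis using cmod_char_le_1[of z] char_\<mu>[of 1 z] by (simp add: \<psi>_def norm_exp_eq_Re)
  qed
  have [measurable]: "\<psi> \<in> borel_measurable borel"
    unfolding \<psi>_def by measurable
  \<comment> \<open>For n > 0, \<open>a n\<close> is the exponent belonging to the measure n
    \<open>\<mu> n\<close>, as \<open>\<psi>\<close> is the one belonging to F. It converges
    pointwise to \<open>\<psi>\<close> under a bound uniform in n, so its Gaussian averages converge
    as well.\<close>
  define a where "a n z = of_nat n * (exp (\<psi> z / of_nat n) - 1)" for n :: nat and z
  have a_lim: "(\<lambda>n. a n z) \<longlonglongrightarrow> \<psi> z" for z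
    unfolding a_def by (rule LIMSEQ_of_nat_mult_exp_minus_one)
  have a_bound: "norm (a n z) \<le> K * \<bar>z\<bar>" for n z
  proof (cases "n = 0")
    case False
    have "norm (exp (\<psi> z / of_nat n) - 1) \<le> norm (\<psi> z / of_nat n)"
      using Re_\<psi>[of z] by (intro norm_exp_minus_one_le) (simp add: divide_nonpos_nonneg)
    then have "norm (a n z) \<le> norm (\<psi> z)"
      using False unfolding a_def norm_mult by (simp add: norm_divide pos_le_divide_eq mult.commute)
    then show ?thesis using bound[of z] by simp
  qed (use K in \<open>simp add: a_def\<close>)
  have int_abs_N: "integrable ?N (\<lambda>g. K * \<bar>z + g\<bar>)" for z
    using integrable_std_normal_distribution_moment[of 1] by simp
  have "(\<lambda>n. CLINT g|?N. a n (z + g)) \<longlonglongrightarrow> (CLINT g|?N. \<psi> (z + g))" for z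
    by (rule integral_dominated_convergence[OF _ _ int_abs_N]) (auto simp: a_def intro: a_lim[unfolded a_def] a_bound[unfolded a_def])
  then have lim: "(\<lambda>n. a n z - (CLINT g|?N. a n (z + g))) \<longlonglongrightarrow> \<psi> z - (CLINT g|?N. \<psi> (z + g))" for z
    by (intro tendsto_diff a_lim)
  \<comment> \<open>The integrand is dominated by |(z + g) x|, whose double integral factors into
    two finite first moments.\<close>
  have int2_F: "integrable (?N \<Otimes>\<^sub>M F) (\<lambda>(g, x). iexp ((z + g) * x) - 1)" for z
  proof (rule Bochner_Integration.integrable_bound)
    have "integrable ?N (\<lambda>g. \<bar>z + g\<bar>)" using integrable_std_normal_distribution_moment[of 1] by simp
    then have "integrable ?N (\<lambda>g. \<integral>x. norm (case (g, x) of (g, x) \<Rightarrow> (z + g) * x) \<partial>F)"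
      by (simp add: abs_mult)
    moreover have "AE g in ?N. integrable F (\<lambda>x. case (g, x) of (g, x) \<Rightarrow> (z + g) * x)"
      using int by simp
    ultimately show "integrable (?N \<Otimes>\<^sub>M F) (\<lambda>(g, x). (z + g) * x)"
      by (rule P.Fubini_integrable[rotated]) measurable
    show "AE y in ?N \<Otimes>\<^sub>M F. norm (case y of (g, x) \<Rightarrow> iexp ((z + g) * x) - 1) \<le> norm (case y of (g, x) \<Rightarrow> (z + g) * x)"
    proof (intro AE_I2)
      fix y show "norm (case y of (g, x) \<Rightarrow> iexp ((z + g) * x) - 1) \<le> norm (case y of (g, x) \<Rightarrow> (z + g) * x)"
        using norm_iexp_minus_one_le[of "(z + fst y) * snd y"] unfolding case_prod_beta real_norm_def .
    qed
  qed measurable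
  note F = gaussian_average_char[OF sf sets int_F int2_F, folded \<psi>_def]
  have \<mu>_weight: "integrable (\<mu> n) (\<lambda>x. gauss_weight x *\<^sub>R iexp (z * x))"
      "of_nat n * (CLINT x|\<mu> n. gauss_weight x *\<^sub>R iexp (z * x)) = a n z - (CLINT g|?N. a n (z + g))"
    if "0 < n" for n z
  proof -
    interpret real_distribution "\<mu> n" using \<mu>[OF that] .
    interpret Q: pair_prob_space ?N "\<mu> n" ..
    have i: "integrable (\<mu> n) (\<lambda>x. iexp (z * x))" for z
      by (rule integrable_iexp) auto
    have c: "(CLINT x|\<mu> n. iexp (z * x) - 1) = a n z / of_nat n" for z
    proof -
      have "(CLINT x|\<mu> n. iexp (z * x) - 1) = char (\<mu> n) z - 1"
        using i prob_space by (simp add: char_def Bochner_Integration.integral_diff)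
      then show ?thesis using that char_\<mu>[OF that, of z] by (simp add: a_def \<psi>_def)
    qed
    have i2: "integrable (?N \<Otimes>\<^sub>M \<mu> n) (\<lambda>(g, x). iexp ((z + g) * x) - 1)"
      using norm_iexp_minus_one_le_2[of "(z + _) * _"]
      by (intro Q.P.integrable_const_bound[of _ 2]) auto
    have i1: "integrable (\<mu> n) (\<lambda>x. iexp (z * x) - 1)" using i by simp
    note * = gaussian_average_char[OF sigma_finite_measure_axioms events_eq_borel i1 i2]
    show "integrable (\<mu> n) (\<lambda>x. gauss_weight x *\<^sub>R iexp (z * x))" by fact
    show "of_nat n * (CLINT x|\<mu> n. gauss_weight x *\<^sub>R iexp (z * x)) = a n z - (CLINT g|?N. a n (z + g))"
      using that unfolding *(2)[symmetric] c by (simp add: right_diff_distrib)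
  qed
  have J: "(\<lambda>n. of_nat n * (CLINT x|\<mu> n. gauss_weight x *\<^sub>R iexp (z * x)))
      \<longlonglongrightarrow> (CLINT x|F. gauss_weight x *\<^sub>R iexp (z * x))" for z
    unfolding F(2)[symmetric]
    by (rule Lim_transform_eventually[OF lim eventually_mono[OF eventually_gt_at_top[of 0]]])
       (rule \<mu>_weight(2)[symmetric])
  have int_weight: "integrable M gauss_weight" "(CLINT x|M. gauss_weight x *\<^sub>R iexp (0 * x)) = of_real (\<integral>x. gauss_weight x \<partial>M)"
    if "integrable M (\<lambda>x. gauss_weight x *\<^sub>R iexp (0 * x))" for M
  proof -
    have "integrable M (\<lambda>x. complex_of_real (gauss_weight x))"
      using that by (simp add: scaleR_conv_of_real)
    then show "integrable M gauss_weight" by (simp only: complex_of_real_integrable_eq)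
  qed (simp add: scaleR_conv_of_real)
  define c where "c = (\<integral>x. gauss_weight x \<partial>F)"
  define d where "d n = (\<integral>x. gauss_weight x \<partial>\<mu> n)" for n
  have int_w\<mu>: "integrable (\<mu> n) gauss_weight" if "0 < n" for n
    using int_weight(1) \<mu>_weight(1)[OF that, of 0] by blast
  have int_wF: "integrable F gauss_weight"
    using int_weight(1) F(1)[of 0] by blast
  have d_nonneg: "0 \<le> d n" for n
    by (simp add: d_def gauss_weight_nonneg)
  \<comment> \<open>The total weighted masses are the weighted transforms at z = 0.\<close>
  have d_lim: "(\<lambda>n. real n * d n) \<longlonglongrightarrow> c"
  proof -
    have "(\<lambda>n. complex_of_real (real n * d n)) \<longlonglongrightarrow> complex_of_real c"
    proof (rule Lim_transform_eventually)
      show "(\<lambda>n. of_nat n * (CLINT x|\<mu> n. gauss_weight x *\<^sub>R iexp (0 * x))) \<longlonglongrightarrow> complex_of_real c"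
        using J[of 0] unfolding c_def int_weight(2)[OF F(1)[of 0]] .
      show "\<forall>\<^sub>F n in sequentially. of_nat n * (CLINT x|\<mu> n. gauss_weight x *\<^sub>R iexp (0 * x)) = complex_of_real (real n * d n)"
        using eventually_gt_at_top[of 0]
      proof eventually_elim
        case (elim n)
        show ?case unfolding d_def int_weight(2)[OF \<mu>_weight(1)[OF elim, of 0]] by simp
      qed
    qed
    then show ?thesis by (simp only: tendsto_of_real_iff)
  qed
  show ?thesis
  proof (cases "0 < c")
    \<comment> \<open>With weighted mass 0 there is nothing to normalise. Beyond u the weight is at
      least \<open>gauss_weight u\<close>, so a Markov bound shows that the limit and the tail mass
      of F are both 0.\<close>
    case False
    moreover have "0 \<le> c" by (simp add: c_def gauss_weight_nonneg)
    ultimately have c: "c = 0" by simp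
    have tail: "measure M {u<..} \<le> (\<integral>x. gauss_weight x \<partial>M) / gauss_weight u"
      if "integrable M gauss_weight" and [measurable_cong]: "sets M = sets borel" for M
    proof -
      have "measure M {u<..} = (\<integral>x. indicator {u<..} x \<partial>M)"
        using sets_eq_imp_space_eq[OF that(2)] by simp
      also have "\<dots> \<le> (\<integral>x. gauss_weight x / gauss_weight u \<partial>M)"
        using that u gauss_weight_mono[of u] gauss_weight_pos[of u]
        by (intro integral_mono') (auto simp: indicator_def gauss_weight_nonneg)
      finally show ?thesis by simp
    qed
    have "(\<lambda>n. real n * measure (\<mu> n) {u<..}) \<longlonglongrightarrow> 0"
    proof (rule tendsto_sandwich[of "\<lambda>_. 0" _ _ "\<lambda>n. real n * d n / gauss_weight u"])
      show "(\<lambda>n. real n * d n / gauss_weight u) \<longlonglongrightarrow> 0"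
        using tendsto_divide[OF d_lim tendsto_const, of "gauss_weight u"] gauss_weight_pos[of u] u by (simp add: c)
      show "\<forall>\<^sub>F n in sequentially. real n * measure (\<mu> n) {u<..} \<le> real n * d n / gauss_weight u"
        using eventually_gt_at_top[of 0]
      proof eventually_elim
        case (elim n)
        have "measure (\<mu> n) {u<..} \<le> d n / gauss_weight u"
          unfolding d_def using elim by (intro tail int_w\<mu> real_distribution.events_eq_borel \<mu>)
        then show ?case by (metis mult_left_mono of_nat_0_le_iff times_divide_eq_right)
      qed
    qed auto
    moreover have "measure F {u<..} = 0"
      using tail[OF int_wF sets] c by (intro antisym measure_nonneg) (simp add: c_def)
    ultimately show ?thesis by simp
  next
    case True
    \<comment> \<open>The fallback \<open>gauss_tilt F\<close> makes every term a probability law,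
      as the continuity theorem demands; \<open>ev\<close> shows that it is taken only finitely
      often.\<close>
    define \<nu> where "\<nu> n = (if 0 < n \<and> 0 < d n then gauss_tilt (\<mu> n) else gauss_tilt F)" for n
    have ev: "\<forall>\<^sub>F n in sequentially. 0 < n \<and> 0 < d n"
      using order_tendstoD(1)[OF d_lim True] by eventually_elim (auto simp: zero_less_mult_iff)
    have dist_F: "real_distribution (gauss_tilt F)"
      using True by (intro real_distribution_gauss_tilt sets int_wF) (simp add: c_def)
    have dist_\<nu>: "real_distribution (\<nu> n)" for n
      using dist_F real_distribution.events_eq_borel[OF \<mu>] int_w\<mu>
      by (auto simp: \<nu>_def d_def intro!: real_distribution_gauss_tilt)
    have "weak_conv_m \<nu> (gauss_tilt F)"
    proof (rule levy_continuity[OF dist_\<nu> dist_F])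
      fix z
      let ?J = "\<lambda>M. CLINT x|M. gauss_weight x *\<^sub>R iexp (z * x)"
      have "(\<lambda>n. (of_nat n * ?J (\<mu> n)) / of_real (real n * d n)) \<longlonglongrightarrow> ?J F / of_real c"
        using True by (intro tendsto_divide J tendsto_of_real d_lim) simp
      moreover have "\<forall>\<^sub>F n in sequentially. (of_nat n * ?J (\<mu> n)) / of_real (real n * d n) = char (\<nu> n) z"
        using ev
      proof eventually_elim
        case (elim n)
        then have "char (\<nu> n) z = ?J (\<mu> n) / of_real (d n)"
          using char_gauss_tilt[OF real_distribution.events_eq_borel[OF \<mu>] int_w\<mu>, of n] by (simp add: \<nu>_def d_def)
        then show ?case using elim by simp
      qed
      ultimately show "(\<lambda>n. char (\<nu> n) z) \<longlonglongrightarrow> char (gauss_tilt F) z"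
        using char_gauss_tilt[OF sets int_wF] True Lim_transform_eventually by (fastforce simp: c_def)
    qed
    \<comment> \<open>Dividing by the weight turns the tilted integral back into a tail mass. As u >
      0, this function is bounded and discontinuous at most at u, which F does not charge, so weak
      convergence transfers to its integrals.\<close>
    let ?f = "\<lambda>x. indicator {u<..} x / gauss_weight x"
    have "(\<lambda>n. integral\<^sup>L (\<nu> n) ?f) \<longlonglongrightarrow> integral\<^sup>L (gauss_tilt F) ?f"
    proof (rule weak_conv_imp_bdd_ae_continuous_conv[OF dist_\<nu> dist_F \<open>weak_conv_m \<nu> _\<close>])
      have "isCont ?f x" if "x \<noteq> u" for x
      proof (cases "x < u")
        case True
        then have "\<forall>\<^sub>F y in nhds x. y < u" by (intro eventually_nhds_in_open[of "{..<u}", simplified]) auto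
        then have "\<forall>\<^sub>F y in nhds x. ?f y = 0" by eventually_elim simp
        then show ?thesis using isCont_cong[of ?f "\<lambda>_. 0" x] by simp
      next
        case False
        then have "x > u" using that by simp
        then show ?thesis using u gauss_weight_pos[of x]
          by (intro isCont_divide isCont_gauss_weight) (auto simp: isCont_indicator)
      qed
      then have sub: "{x. \<not> isCont ?f x} \<subseteq> {u}" by auto
      have "emeasure (gauss_tilt F) {u} = 0"
        unfolding gauss_tilt_def using u(2) by (subst emeasure_density) (auto intro!: nn_integral_null_set simp: null_sets_def sets)
      then show "emeasure (gauss_tilt F) {x. \<not> isCont ?f x} = 0"
        using emeasure_mono[OF sub, of "gauss_tilt F"] by (simp add: gauss_tilt_def sets)
      show "norm (?f x) \<le> 1 / gauss_weight u" for x
        using u gauss_weight_pos[of u] gauss_weight_mono[of u x] gauss_weight_nonneg[of x]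
        by (auto simp: indicator_def intro!: divide_left_mono)
    qed measurable
    then have "(\<lambda>n. (real n * d n) * integral\<^sup>L (\<nu> n) ?f) \<longlonglongrightarrow> c * integral\<^sup>L (gauss_tilt F) ?f"
      by (intro tendsto_mult d_lim)
    also have "c * integral\<^sup>L (gauss_tilt F) ?f = measure F {u<..}"
      using integral_tail_gauss_tilt[OF sets int_wF, of u] True u by (simp add: c_def)
    finally show ?thesis
    proof (rule Lim_transform_eventually)
      show "\<forall>\<^sub>F n in sequentially. (real n * d n) * integral\<^sup>L (\<nu> n) ?f = real n * measure (\<mu> n) {u<..}"
        using ev
      proof eventually_elim
        case (elim n)
        then show ?case
          using integral_tail_gauss_tilt[OF real_distribution.events_eq_borel[OF \<mu>] int_w\<mu>, of n u] u
          by (simp add: \<nu>_def d_def)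
      qed
    qed
  qed
qed

section \<open>Characteristic functions at the times 1/n\<close>

text \<open>The quotient of the two sides is continuous with values among the finitely many n-th
  roots of unity, hence constant on the connected line, and it equals 1 at 0. This selects the right
  branch of the n-th root.\<close>

lemma nth_root_exp_unique:
  fixes \<phi> \<psi> :: "real \<Rightarrow> complex"
  assumes "continuous_on UNIV \<phi>" "continuous_on UNIV \<psi>" "\<phi> 0 = 1" "\<psi> 0 = 0" "0 < n"
    and pow: "\<And>z. \<phi> z ^ n = exp (\<psi> z)"
  shows "\<phi> z = exp (\<psi> z / of_nat n)"
proof -
  let ?f = "\<lambda>z. \<phi> z / exp (\<psi> z / of_nat n)"
  have "?f z ^ n = 1" for z
    using assms(5) by (simp add: power_divide pow exp_of_nat_mult[symmetric])
  then have "range ?f \<subseteq> {w. w ^ n = 1}" by auto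
  then have "finite (range ?f)"
    using finite_roots_unity[of n] assms(5) finite_subset by (metis Suc_leI One_nat_def)
  moreover have "continuous_on UNIV ?f"
    using assms by (intro continuous_intros) auto
  ultimately obtain c where "?f z = c" for z
    using continuous_finite_range_constant[of UNIV ?f] by (auto simp: constant_on_def)
  from this[of 0] this[of z] show ?thesis using assms by (simp add: field_simps)
qed

lemma (in levy_process) char_X_1_eq_power:
  assumes n: "0 < n"
  shows "char (distr M borel (X 1)) z = char (distr M borel (X (1 / real n))) z ^ n"
proof -
  let ?D = "\<lambda>i \<omega>. X (real (Suc i) / real n) \<omega> - X (real i / real n) \<omega>"
  have ind: "indep_vars (\<lambda>_. borel) ?D {..<n}"
    using indep_increments[of "\<lambda>i. real i / real n" n] by (simp add: divide_right_mono)
  have D: "distr M borel (?D i) = distr M borel (X (1 / real n))" for i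
    using stationary_increments[of "real i / real n" "real (Suc i) / real n"] n
    by (simp add: divide_right_mono diff_divide_distrib[symmetric])
  \<comment> \<open>The increments telescope to X 1 - X 0, which equals X 1 only almost
    surely.\<close>
  have "distr M borel (X 1) = distr M borel (\<lambda>\<omega>. \<Sum>i<n. ?D i \<omega>)"
  proof (rule distr_cong_AE)
    show "AE \<omega> in M. X 1 \<omega> = (\<Sum>i<n. ?D i \<omega>)"
      using X_0
    proof eventually_elim
      case (elim \<omega>)
      then show ?case using sum_lessThan_telescope[of "\<lambda>i. X (real i / real n) \<omega>" n] n by simp
    qed
  qed (use measurable_X in \<open>auto intro!: borel_measurable_sum borel_measurable_diff\<close>)
  then show ?thesis by (simp add: char_distr_sum[OF ind] D del: of_nat_Suc)
qed

text \<open>Dominated convergence: along a convergent, hence bounded, sequence of arguments the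
  integrand is at most B |x|.\<close>

lemma continuous_on_levy_exponent:
  fixes F :: "real measure"
  assumes [measurable_cong]: "sets F = sets borel" and int: "integrable F (\<lambda>x. x)"
  shows "continuous_on UNIV (\<lambda>z. CLINT x|F. iexp (z * x) - 1)"
proof (rule continuous_on_sequentiallyI)
  fix u :: "nat \<Rightarrow> real" and z assume u: "u \<longlonglongrightarrow> z"
  obtain B where B: "\<And>n. \<bar>u n\<bar> \<le> B"
    using convergent_imp_Bseq[OF convergentI[OF u]] by (auto simp: Bseq_def)
  show "(\<lambda>n. CLINT x|F. iexp (u n * x) - 1) \<longlonglongrightarrow> (CLINT x|F. iexp (z * x) - 1)"
  proof (rule integral_dominated_convergence)
    show "integrable F (\<lambda>x. B * \<bar>x\<bar>)" using int by simp
    show "AE x in F. (\<lambda>n. iexp (u n * x) - 1) \<longlonglongrightarrow> iexp (z * x) - 1"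
      by (intro AE_I2 tendsto_intros u)
    fix n show "AE x in F. norm (iexp (u n * x) - 1) \<le> B * \<bar>x\<bar>"
    proof (rule AE_I2)
      fix x
      have "norm (iexp (u n * x) - 1) \<le> \<bar>u n * x\<bar>" by (rule norm_iexp_minus_one_le)
      also have "\<dots> \<le> B * \<bar>x\<bar>" unfolding abs_mult by (intro mult_right_mono B) simp
      finally show "norm (iexp (u n * x) - 1) \<le> B * \<bar>x\<bar>" .
    qed
  qed measurable
qed

section \<open>Tails of the tempered stable Levy measure\<close>

text \<open>This is the reason for the choice of \<open>phi\<close>: it makes the leading tail term
  (\<alpha>/\<beta>) u^(-\<beta>) affine in k at u = \<open>phi \<beta> k\<close>, with slope
  \<alpha>.\<close>

lemma phi_powr:
  assumes "0 < \<beta>" "0 \<le> x"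
  shows "phi \<beta> x powr (- \<beta>) = 1 + \<beta> * x"
proof -
  have "0 < 1 + \<beta> * x" using assms by (intro add_pos_nonneg) auto
  then show ?thesis using assms(1) by (simp add: phi_def powr_powr)
qed

lemma phi_pos:
  assumes "0 < \<beta>" "0 \<le> x"
  shows "0 < phi \<beta> x"
proof -
  have "0 < 1 + \<beta> * x" using assms by (intro add_pos_nonneg) auto
  then show ?thesis by (simp add: phi_def)
qed

lemma phi_strict_antimono: "0 < \<beta> \<Longrightarrow> 0 \<le> x \<Longrightarrow> x < y \<Longrightarrow> phi \<beta> y < phi \<beta> x"
  unfolding phi_def by (rule powr_less_mono2_neg) (auto intro: add_pos_nonneg)

lemma phi_le_1: "0 < \<beta> \<Longrightarrow> 0 \<le> x \<Longrightarrow> phi \<beta> x \<le> 1"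
  using phi_strict_antimono[of \<beta> 0 x] by (cases "x = 0") (auto simp: phi_def)

lemma powr_minus_minus_one: "x powr (- \<beta> - 1) = 1 / x powr (1 + \<beta>)" for x \<beta> :: real
proof -
  have "- \<beta> - 1 = - (1 + \<beta>)" by simp
  then show ?thesis by (simp only: powr_minus_divide)
qed

lemma sets_TS_levy_measure [simp]: "sets (TS_levy_measure \<alpha> \<beta> lam) = sets borel"
  by (simp add: TS_levy_measure_def)

lemma sigma_finite_TS_levy_measure: "sigma_finite_measure (TS_levy_measure \<alpha> \<beta> lam)"
  unfolding TS_levy_measure_def 
  by (subst sigma_finite_measure.sigma_finite_iff_density_finite[OF sigma_finite_lborel]) auto

lemma emeasure_TS_levy_measure_singleton: "emeasure (TS_levy_measure \<alpha> \<beta> lam) {u} = 0"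
  unfolding TS_levy_measure_def
  by (subst emeasure_density) (auto intro!: nn_integral_null_set)

context
  fixes \<alpha> \<beta> lam :: real
  assumes \<alpha>: "0 < \<alpha>" and lam: "0 < lam" and \<beta>: "0 < \<beta>" "\<beta> < 1"
begin

text \<open>Multiplying the density by x leaves \<alpha> x^(-\<beta>) exp(-lam x), a Gamma integrand
  with parameter 1 - \<beta> > 0.\<close>

lemma integrable_TS_levy_measure: "integrable (TS_levy_measure \<alpha> \<beta> lam) (\<lambda>x. x)"
proof -
  let ?f = "\<lambda>t. complex_of_real t powr (complex_of_real (1 - \<beta>) - 1) / of_real (exp (lam * t))"
  have "?f absolutely_integrable_on {0<..}"
    using absolutely_integrable_Gamma_integral[of "complex_of_real (1 - \<beta>)" lam] lam \<beta> by simp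
  then have "integrable lebesgue (\<lambda>t. norm (indicator {0<..} t *\<^sub>R ?f t))"
    unfolding set_integrable_def by (rule integrable_norm)
  also have "(\<lambda>t. norm (indicator {0<..} t *\<^sub>R ?f t)) = (\<lambda>t. indicator {0<..} t * (t powr (- \<beta>) * exp (- lam * t)))"
    by (auto simp: fun_eq_iff indicator_def norm_divide norm_powr_real_powr exp_minus field_simps)
  finally have "integrable lborel (\<lambda>t. indicator {0<..} t * (t powr (- \<beta>) * exp (- lam * t)))"
    by (subst (asm) integrable_completion) measurable
  then have "integrable lborel (\<lambda>t. \<alpha> * (indicator {0<..} t * (t powr (- \<beta>) * exp (- lam * t))))"
    by simp
  also have "(\<lambda>t. \<alpha> * (indicator {0<..} t * (t powr (- \<beta>) * exp (- lam * t))))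
      = (\<lambda>t. (\<alpha> / t powr (1 + \<beta>) * exp (- lam * t) * indicator {0<..} t) *\<^sub>R t)"
    by (auto simp: fun_eq_iff indicator_def powr_add powr_minus field_simps)
  finally show ?thesis
    unfolding TS_levy_measure_def using \<alpha> by (subst integrable_density) (auto simp: indicator_def)
qed

text \<open>Bound the exponential factor by 1 and integrate the remaining power up to
  infinity.\<close>

lemma TS_levy_measure_tail_upper:
  assumes u: "0 < u"
  shows "emeasure (TS_levy_measure \<alpha> \<beta> lam) {u<..} \<le> ennreal (\<alpha> / \<beta> * u powr (- \<beta>))"
proof -
  have "emeasure (TS_levy_measure \<alpha> \<beta> lam) {u<..}
      = (\<integral>\<^sup>+x. ennreal (\<alpha> / x powr (1 + \<beta>) * exp (- lam * x) * indicator {0<..} x) * indicator {u<..} x \<partial>lborel)"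
    unfolding TS_levy_measure_def by (rule emeasure_density) auto
  also have "\<dots> \<le> (\<integral>\<^sup>+x. ennreal (\<alpha> * x powr (- \<beta> - 1)) * indicator {u..} x \<partial>lborel)"
  proof (rule nn_integral_mono)
    fix x
    have "\<alpha> / x powr (1 + \<beta>) * exp (- lam * x) \<le> \<alpha> * x powr (- \<beta> - 1)" if "u < x"
    proof -
      have "x powr (- \<beta> - 1) = 1 / x powr (1 + \<beta>)" by (rule powr_minus_minus_one)
      then show ?thesis using that u \<alpha> lam by (simp add: divide_right_mono)
    qed
    then show "ennreal (\<alpha> / x powr (1 + \<beta>) * exp (- lam * x) * indicator {0<..} x) * indicator {u<..} x
        \<le> ennreal (\<alpha> * x powr (- \<beta> - 1)) * indicator {u..} x"
      using u by (auto simp: indicator_def intro!: ennreal_leI)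
  qed
  also have "\<dots> = ennreal (0 - (- (\<alpha> / \<beta>) * u powr (- \<beta>)))"
  proof (rule nn_integral_FTC_atLeast)
    fix x assume "u \<le> x"
    then show "((\<lambda>x. - (\<alpha> / \<beta>) * x powr (- \<beta>)) has_real_derivative \<alpha> * x powr (- \<beta> - 1)) (at x)"
      using u \<beta> by (auto intro!: derivative_eq_intros)
    show "0 \<le> \<alpha> * x powr (- \<beta> - 1)" using \<alpha> by simp
  next
    show "((\<lambda>x. - (\<alpha> / \<beta>) * x powr (- \<beta>)) \<longlongrightarrow> 0) at_top"
      using \<beta> by real_asymp
  qed simp
  finally show ?thesis by simp
qed

text \<open>Keep only the mass up to 1 and use exp(-lam x) >= 1 - lam x there. The subtracted
  constant bounds the correction, being the integral of \<alpha> lam x^(-\<beta>) over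
  (0,1).\<close>

lemma TS_levy_measure_tail_lower:
  assumes u: "0 < u" "u \<le> 1"
  shows "\<alpha> / \<beta> * (u powr (- \<beta>) - 1) - \<alpha> * lam / (1 - \<beta>) \<le> measure (TS_levy_measure \<alpha> \<beta> lam) {u<..}"
proof -
  let ?g = "\<lambda>x. \<alpha> * (x powr (- \<beta> - 1) - lam * x powr (- \<beta>))"
  let ?G = "\<lambda>x. \<alpha> * (- (x powr (- \<beta>) / \<beta>) - lam * (x powr (1 - \<beta>) / (1 - \<beta>)))"
  let ?d = "\<lambda>x. \<alpha> / x powr (1 + \<beta>) * exp (- lam * x) * indicator {0<..} x"
  have cont: "continuous_on {u..1} ?g"
    using u by (intro continuous_intros) auto
  have "?G 1 - ?G u = (\<integral>x. indicator {u..1} x *\<^sub>R ?g x \<partial>lborel)"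
  proof (rule integral_FTC_atLeastAtMost[symmetric])
    fix x assume "u \<le> x" "x \<le> 1"
    then have "(?G has_real_derivative \<alpha> * (- (- \<beta> * x powr (- \<beta> - 1) / \<beta>) - lam * ((1 - \<beta>) * x powr (1 - \<beta> - 1) / (1 - \<beta>)))) (at x)"
      using u \<beta> by (auto intro!: derivative_eq_intros)
    then have "(?G has_real_derivative ?g x) (at x)"
      using \<beta> by simp
    then show "(?G has_vector_derivative ?g x) (at x within {u..1})"
      by (auto simp: has_real_derivative_iff_has_vector_derivative intro: has_vector_derivative_at_within)
  qed (use u cont in auto)
  also have "\<dots> \<le> (\<integral>x. ?d x *\<^sub>R indicator {u<..} x \<partial>lborel)"
  proof (rule integral_mono_AE)
    show "integrable lborel (\<lambda>x. indicator {u..1} x *\<^sub>R ?g x)"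
      using borel_integrable_atLeastAtMost'[OF cont] by (simp add: set_integrable_def)
    have "integrable (TS_levy_measure \<alpha> \<beta> lam) (indicator {u<..} :: real \<Rightarrow> real)"
      using TS_levy_measure_tail_upper[OF u(1)] by (auto intro!: integrable_real_indicator simp: less_top[symmetric] top_unique)
    then show "integrable lborel (\<lambda>x. ?d x *\<^sub>R (indicator {u<..} x :: real))"
      unfolding TS_levy_measure_def by (subst (asm) integrable_density) (use \<alpha> in simp_all)
    show "AE x in lborel. indicator {u..1} x *\<^sub>R ?g x \<le> ?d x *\<^sub>R indicator {u<..} x"
      \<comment> \<open>The point u lies in \<open>{u..1}\<close> but not in \<open>{u<..}\<close>,
        so the comparison holds only off this null set.\<close>
      using AE_lborel_singleton[of u]
    proof eventually_elim
      case (elim x)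
      show ?case
      proof (cases "x \<in> {u..1}")
        case True
        have "1 - lam * x \<le> exp (- lam * x)" using exp_ge_add_one_self[of "- lam * x"] by simp
        then have "\<alpha> * x powr (- \<beta> - 1) * (1 - lam * x) \<le> \<alpha> * x powr (- \<beta> - 1) * exp (- lam * x)"
          using \<alpha> by (intro mult_left_mono) auto
        moreover have "x powr (- \<beta> - 1) = 1 / x powr (1 + \<beta>)" by (rule powr_minus_minus_one)
        moreover have "x powr (- \<beta>) = x powr (- \<beta> - 1) * x"
          using True u powr_add[of x "- \<beta> - 1" 1] by simp
        ultimately show ?thesis using True elim u by (simp add: algebra_simps diff_divide_distrib)
      next
        case False
        then show ?thesis using \<alpha> u by (auto simp: indicator_def)
      qed
    qed
  qed
  also have "\<dots> = (\<integral>x. indicator {u<..} x \<partial>TS_levy_measure \<alpha> \<beta> lam)"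
    unfolding TS_levy_measure_def using \<alpha> by (subst integral_density) (auto simp: indicator_def)
  also have "\<dots> = measure (TS_levy_measure \<alpha> \<beta> lam) {u<..}"
    by (simp add: TS_levy_measure_def)
  finally have "?G 1 - ?G u \<le> measure (TS_levy_measure \<alpha> \<beta> lam) {u<..}" .
  moreover have "\<alpha> / \<beta> * (u powr (- \<beta>) - 1) - \<alpha> * lam / (1 - \<beta>) \<le> ?G 1 - ?G u"
  proof -
    have "0 \<le> \<alpha> * (lam * (u powr (1 - \<beta>) / (1 - \<beta>)))" using \<alpha> lam \<beta> by simp
    then show ?thesis by (simp add: algebra_simps diff_divide_distrib)
  qed
  ultimately show ?thesis by linarith
qed

lemma TS_levy_measure_tail_phi:
  assumes "0 \<le> k"
  shows "\<bar>measure (TS_levy_measure \<alpha> \<beta> lam) {phi \<beta> k<..} - \<alpha> * k\<bar> \<le> \<alpha> / \<beta> + \<alpha> * lam / (1 - \<beta>)"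
proof -
  have p: "0 < phi \<beta> k" "phi \<beta> k \<le> 1" using phi_pos phi_le_1 assms \<beta> by auto
  have "measure (TS_levy_measure \<alpha> \<beta> lam) {phi \<beta> k<..} \<le> \<alpha> / \<beta> * phi \<beta> k powr (- \<beta>)"
    unfolding measure_def using TS_levy_measure_tail_upper[OF p(1)] \<alpha> \<beta> by (intro enn2real_leI) auto
  also have "\<dots> = \<alpha> / \<beta> + \<alpha> * k" using \<beta> assms by (simp add: phi_powr field_simps)
  finally have "measure (TS_levy_measure \<alpha> \<beta> lam) {phi \<beta> k<..} \<le> \<alpha> / \<beta> + \<alpha> * k" .
  moreover have "\<alpha> * k - \<alpha> * lam / (1 - \<beta>) \<le> measure (TS_levy_measure \<alpha> \<beta> lam) {phi \<beta> k<..}"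
    using TS_levy_measure_tail_lower[OF p] \<beta> assms by (simp add: phi_powr field_simps)
  moreover have "0 \<le> \<alpha> / \<beta>" "0 \<le> \<alpha> * lam / (1 - \<beta>)" using \<alpha> \<beta> lam by auto
  ultimately show ?thesis by linarith
qed

end

section \<open>Deviations of the jump counts\<close>

text \<open>The function \<theta> b - a (exp \<theta> - 1) vanishes at 0 with derivative b - a, so
  it is positive for small \<theta> having the sign of b - a. Both tails are thus treated at
  once.\<close>

lemma exists_chernoff_exponent:
  fixes a b :: real
  assumes "a \<noteq> b"
  obtains \<theta> where "0 < \<theta> * (b - a)" "a * (exp \<theta> - 1) < \<theta> * b"
proof -
  let ?f = "\<lambda>\<theta>. \<theta> * b - a * (exp \<theta> - 1)"
  have f: "(?f has_real_derivative b - a) (at 0)"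
    by (auto intro!: derivative_eq_intros)
  consider "0 < b - a" | "b - a < 0" using assms by linarith
  then show thesis
  proof cases
    case 1
    obtain d where d: "0 < d" "\<And>h. 0 < h \<Longrightarrow> h < d \<Longrightarrow> ?f 0 < ?f (0 + h)"
      using DERIV_pos_inc_right[OF f 1] by blast
    from d(2)[of "d / 2"] d(1) 1 show thesis
      by (intro that[of "d / 2"]) auto
  next
    case 2
    obtain d where d: "0 < d" "\<And>h. 0 < h \<Longrightarrow> h < d \<Longrightarrow> ?f 0 < ?f (0 - h)"
      using DERIV_neg_dec_left[OF f 2] by blast
    from d(2)[of "d / 2"] d(1) 2 show thesis
      by (intro that[of "- d / 2"]) (auto simp: mult_less_0_iff)
  qed
qed

text \<open>Fatou's lemma for events: the limit inferior is an increasing union of intersections,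
  each contained in all late \<open>A n\<close>.\<close>

lemma (in prob_space) prob_eventually_le:
  assumes A [measurable]: "\<And>n. A n \<in> events"
    and le: "\<forall>\<^sub>F n in sequentially. prob (A n) \<le> B n" and B: "B \<longlonglongrightarrow> b"
  shows "{\<omega> \<in> space M. \<forall>\<^sub>F n in sequentially. \<omega> \<in> A n} \<in> events"
    and "prob {\<omega> \<in> space M. \<forall>\<^sub>F n in sequentially. \<omega> \<in> A n} \<le> b"
proof -
  let ?I = "\<lambda>N. \<Inter>n\<in>{N..}. A n"
  have eq: "{\<omega> \<in> space M. \<forall>\<^sub>F n in sequentially. \<omega> \<in> A n} = (\<Union>N. ?I N)"
    using sets.sets_into_space[OF A] by (auto simp: eventually_sequentially)
  have I: "?I N \<in> events" for N by (intro sets.countable_INT') auto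
  show "{\<omega> \<in> space M. \<forall>\<^sub>F n in sequentially. \<omega> \<in> A n} \<in> events"
    unfolding eq by (intro sets.countable_UN) (use I in auto)
  have "prob (?I N) \<le> b" for N
  proof (rule tendsto_le[OF _ B tendsto_const])
    show "\<forall>\<^sub>F n in sequentially. prob (?I N) \<le> B n"
      using le eventually_ge_at_top[of N]
    proof eventually_elim
      case (elim n)
      have "prob (?I N) \<le> prob (A n)" using elim by (intro finite_measure_mono) auto
      then show ?case using elim by simp
    qed
  qed simp
  moreover have "(\<lambda>N. prob (?I N)) \<longlonglongrightarrow> prob (\<Union>N. ?I N)"
    using I by (intro finite_Lim_measure_incseq) (auto simp: incseq_def)
  ultimately show "prob {\<omega> \<in> space M. \<forall>\<^sub>F n in sequentially. \<omega> \<in> A n} \<le> b"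
    unfolding eq by (intro LIMSEQ_le_const2) auto
qed

context levy_process
begin

lemma grid_count_eq_sum:
  "real (card (grid_increments_above (\<lambda>t. X t \<omega>) n u)) =
     (\<Sum>i<n. indicator {u<..} (X (real (Suc i) / real n) \<omega> - X (real i / real n) \<omega>))"
proof -
  have "(\<Sum>i<n. indicator {u<..} (X (real (Suc i) / real n) \<omega> - X (real i / real n) \<omega>) :: real)
      = (\<Sum>i\<in>grid_increments_above (\<lambda>t. X t \<omega>) n u. 1)"
    by (rule sum.mono_neutral_cong_right) (auto simp: grid_increments_above_def)
  then show ?thesis by simp
qed

lemma measurable_grid_count [measurable]:
  "(\<lambda>\<omega>. real (card (grid_increments_above (\<lambda>t. X t \<omega>) n u))) \<in> borel_measurable M"
proof -
  have [measurable]: "X (real i / real n) \<in> borel_measurable M" for i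
    by (rule measurable_X) simp
  show ?thesis unfolding grid_count_eq_sum by measurable
qed

text \<open>The count is a sum of n independent Bernoulli variables with the same success
  probability q. Its exponential moment (1 + (exp \<theta> - 1) q)^n is bounded by that of a Poisson
  variable with mean n q.\<close>

lemma expectation_exp_grid_count:
  assumes n: "0 < n"
  shows "integrable M (\<lambda>\<omega>. exp (\<theta> * real (card (grid_increments_above (\<lambda>t. X t \<omega>) n u))))"
    and "expectation (\<lambda>\<omega>. exp (\<theta> * real (card (grid_increments_above (\<lambda>t. X t \<omega>) n u))))
           \<le> exp (real n * measure (distr M borel (X (1 / real n))) {u<..} * (exp \<theta> - 1))"
proof -
  let ?D = "\<lambda>i \<omega>. X (real (Suc i) / real n) \<omega> - X (real i / real n) \<omega>"
  let ?e = "\<lambda>x. exp (\<theta> * indicator {u<..} x)"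
  define q where "q = measure (distr M borel (X (1 / real n))) {u<..}"
  have [measurable]: "X (real i / real n) \<in> borel_measurable M" for i
    by (rule measurable_X) simp
  have [measurable]: "X (1 / real n) \<in> borel_measurable M"
    by (rule measurable_X) simp
  have "indep_vars (\<lambda>_. borel) ?D {..<n}"
    using indep_increments[of "\<lambda>i. real i / real n" n] by (simp add: divide_right_mono)
  then have ind: "indep_vars (\<lambda>_. borel) (\<lambda>i \<omega>. ?e (?D i \<omega>)) {..<n}"
    by (rule indep_vars_compose2) measurable
  have eq: "exp (\<theta> * real (card (grid_increments_above (\<lambda>t. X t \<omega>) n u))) = (\<Prod>i<n. ?e (?D i \<omega>))" for \<omega>
    unfolding grid_count_eq_sum sum_distrib_left by (rule exp_sum) simp
  have int: "integrable M (\<lambda>\<omega>. ?e (?D i \<omega>))" for i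
  proof (rule integrable_const_bound[of _ "exp \<bar>\<theta>\<bar>"])
    show "AE \<omega> in M. norm (?e (?D i \<omega>)) \<le> exp \<bar>\<theta>\<bar>" by (auto simp: indicator_def)
  qed measurable
  show "integrable M (\<lambda>\<omega>. exp (\<theta> * real (card (grid_increments_above (\<lambda>t. X t \<omega>) n u))))"
    unfolding eq using ind int by (intro indep_vars_integrable) auto
  have E: "expectation (\<lambda>\<omega>. ?e (?D i \<omega>)) = 1 + (exp \<theta> - 1) * q" for i
  proof -
    have e_meas: "?e \<in> borel_measurable borel" by measurable
    have D_meas: "?D i \<in> borel_measurable M" by measurable
    have D: "distr M borel (?D i) = distr M borel (X (1 / real n))"
      using stationary_increments[of "real i / real n" "real (Suc i) / real n"] n
      by (simp add: divide_right_mono diff_divide_distrib[symmetric])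
    interpret D: prob_space "distr M borel (X (1 / real n))" by (rule prob_space_distr) simp
    have "expectation (\<lambda>\<omega>. ?e (?D i \<omega>)) = (\<integral>x. ?e x \<partial>distr M borel (?D i))"
      by (rule integral_distr[OF D_meas e_meas, symmetric])
    also have "\<dots> = (\<integral>x. 1 + (exp \<theta> - 1) * indicator {u<..} x \<partial>distr M borel (X (1 / real n)))"
      unfolding D by (intro Bochner_Integration.integral_cong) (auto simp: indicator_def)
    also have "\<dots> = 1 + (exp \<theta> - 1) * q"
      using D.prob_space by (simp add: q_def D.emeasure_eq_measure)
    finally show ?thesis .
  qed
  have "expectation (\<lambda>\<omega>. exp (\<theta> * real (card (grid_increments_above (\<lambda>t. X t \<omega>) n u)))) = (1 + (exp \<theta> - 1) * q) ^ n"
    unfolding eq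
    by (subst indep_vars_lebesgue_integral[OF _ ind int]) (simp_all only: E prod_constant card_lessThan finite_lessThan)
  also have "\<dots> \<le> exp ((exp \<theta> - 1) * q) ^ n"
  proof (rule power_mono)
    \<comment> \<open>Monotonicity of the power requires a nonnegative base; the base is the
      expectation of a positive variable.\<close>
    have "0 \<le> expectation (\<lambda>\<omega>. ?e (?D 0 \<omega>))" by simp
    then show "0 \<le> 1 + (exp \<theta> - 1) * q" by (simp only: E)
  qed (rule exp_ge_add_one_self)
  also have "\<dots> = exp (real n * q * (exp \<theta> - 1))"
    by (simp add: exp_of_nat_mult[symmetric] mult_ac)
  finally show "expectation (\<lambda>\<omega>. exp (\<theta> * real (card (grid_increments_above (\<lambda>t. X t \<omega>) n u))))
      \<le> exp (real n * measure (distr M borel (X (1 / real n))) {u<..} * (exp \<theta> - 1))"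
    by (simp add: q_def)
qed

text \<open>Markov's inequality for the exponential moment. Keeping the factor \<theta> in the event
  lets positive \<theta> describe the upper tail and negative \<theta> the lower one.\<close>

lemma prob_grid_count_chernoff:
  assumes n: "0 < n"
  shows "prob {\<omega> \<in> space M. \<theta> * b \<le> \<theta> * real (card (grid_increments_above (\<lambda>t. X t \<omega>) n u))}
     \<le> exp (real n * measure (distr M borel (X (1 / real n))) {u<..} * (exp \<theta> - 1) - \<theta> * b)"
proof -
  let ?c = "\<lambda>\<omega>. real (card (grid_increments_above (\<lambda>t. X t \<omega>) n u))"
  have "prob {\<omega> \<in> space M. \<theta> * b \<le> \<theta> * ?c \<omega>} = prob {\<omega> \<in> space M. exp (\<theta> * b) \<le> exp (\<theta> * ?c \<omega>)}"
    by simp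
  also have "\<dots> \<le> expectation (\<lambda>\<omega>. exp (\<theta> * ?c \<omega>)) / exp (\<theta> * b)"
    by (rule integral_Markov_inequality_measure[where A="{}"]) (use expectation_exp_grid_count[OF n] in auto)
  also have "\<dots> \<le> exp (real n * measure (distr M borel (X (1 / real n))) {u<..} * (exp \<theta> - 1)) / exp (\<theta> * b)"
    by (intro divide_right_mono expectation_exp_grid_count[OF n]) simp
  finally show ?thesis by (simp add: exp_diff)
qed

text \<open>Two limits in order: for fixed k the mesh tends to 0 and the Chernoff bounds converge;
  then the limiting bounds decay geometrically in k, and Borel-Cantelli applies. The inner
  eventuality in n matches the comparison of paths with grids, which holds only for fine
  grids.\<close>

lemma AE_grid_count_deviation:
  fixes \<Lambda> u :: "nat \<Rightarrow> real"
  assumes \<Lambda>: "\<And>k. (\<lambda>n. real n * measure (distr M borel (X (1 / real n))) {u k<..}) \<longlonglongrightarrow> \<Lambda> k"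
    and bound: "\<And>k. \<bar>\<Lambda> k - a * real k\<bar> \<le> C"
    and \<theta>: "a * (exp \<theta> - 1) < \<theta> * b"
  shows "AE \<omega> in M. \<forall>\<^sub>F k in sequentially. \<not> (\<forall>\<^sub>F n in sequentially.
           \<theta> * (b * real k) \<le> \<theta> * real (card (grid_increments_above (\<lambda>t. X t \<omega>) n (u k))))"
proof -
  let ?c = "\<lambda>k n \<omega>. real (card (grid_increments_above (\<lambda>t. X t \<omega>) n (u k)))"
  define A where "A k n = {\<omega> \<in> space M. \<theta> * (b * real k) \<le> \<theta> * ?c k n \<omega>}" for k n
  define E where "E k = {\<omega> \<in> space M. \<forall>\<^sub>F n in sequentially. \<omega> \<in> A k n}" for k
  \<comment> \<open>The hypothesis on \<theta> says precisely that r < 1; the bounded error in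
    \<open>\<Lambda> k\<close> costs only a constant factor.\<close>
  define r where "r = exp (a * (exp \<theta> - 1) - \<theta> * b)"
  have [measurable]: "A k n \<in> events" for k n unfolding A_def by measurable
  have ev: "\<forall>\<^sub>F n in sequentially. prob (A k n) \<le>
      exp (real n * measure (distr M borel (X (1 / real n))) {u k<..} * (exp \<theta> - 1) - \<theta> * (b * real k))" for k
    using eventually_gt_at_top[of 0] unfolding A_def by eventually_elim (rule prob_grid_count_chernoff)
  have lim: "(\<lambda>n. exp (real n * measure (distr M borel (X (1 / real n))) {u k<..} * (exp \<theta> - 1) - \<theta> * (b * real k)))
      \<longlonglongrightarrow> exp (\<Lambda> k * (exp \<theta> - 1) - \<theta> * (b * real k))" for k
    by (intro tendsto_intros \<Lambda>)
  have E [measurable]: "E k \<in> events" for k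
    unfolding E_def by (rule prob_eventually_le(1)[OF _ ev lim]) simp
  have "prob (E k) \<le> exp (C * \<bar>exp \<theta> - 1\<bar>) * r ^ k" for k
  proof -
    have "prob (E k) \<le> exp (\<Lambda> k * (exp \<theta> - 1) - \<theta> * (b * real k))"
      unfolding E_def by (rule prob_eventually_le(2)[OF _ ev lim]) simp
    also have "\<dots> = exp ((\<Lambda> k - a * real k) * (exp \<theta> - 1) + real k * (a * (exp \<theta> - 1) - \<theta> * b))"
      by (simp add: algebra_simps)
    also have "\<dots> \<le> exp (C * \<bar>exp \<theta> - 1\<bar> + real k * (a * (exp \<theta> - 1) - \<theta> * b))"
    proof -
      have "(\<Lambda> k - a * real k) * (exp \<theta> - 1) \<le> \<bar>\<Lambda> k - a * real k\<bar> * \<bar>exp \<theta> - 1\<bar>"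
        unfolding abs_mult[symmetric] by (rule abs_ge_self)
      also have "\<dots> \<le> C * \<bar>exp \<theta> - 1\<bar>" by (intro mult_right_mono bound) simp
      finally show ?thesis by simp
    qed
    finally show ?thesis by (simp add: exp_add r_def exp_of_nat_mult)
  qed
  then have "norm (prob (E k)) \<le> exp (C * \<bar>exp \<theta> - 1\<bar>) * r ^ k" for k
    by simp
  moreover have "summable (\<lambda>k. exp (C * \<bar>exp \<theta> - 1\<bar>) * r ^ k)"
    using \<theta> by (intro summable_mult summable_geometric) (simp add: r_def)
  ultimately have "summable (\<lambda>k. prob (E k))"
    by (rule summable_comparison_test'[rotated])
  then have "AE \<omega> in M. \<forall>\<^sub>F k in sequentially. \<omega> \<in> space M - E k"
    by (intro borel_cantelli_AE1) (auto simp: emeasure_eq_measure)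
  then show ?thesis
  proof eventually_elim
    case (elim \<omega>)
    then show ?case by eventually_elim (simp add: E_def A_def)
  qed
qed

lemma AE_grid_count_less:
  fixes \<Lambda> u :: "nat \<Rightarrow> real"
  assumes \<Lambda>: "\<And>k. (\<lambda>n. real n * measure (distr M borel (X (1 / real n))) {u k<..}) \<longlonglongrightarrow> \<Lambda> k"
    and bound: "\<And>k. \<bar>\<Lambda> k - a * real k\<bar> \<le> C" and "a < b"
  shows "AE \<omega> in M. \<forall>\<^sub>F k in sequentially. \<not> (\<forall>\<^sub>F n in sequentially.
           b * real k \<le> real (card (grid_increments_above (\<lambda>t. X t \<omega>) n (u k))))"
proof -
  obtain \<theta> where \<theta>: "0 < \<theta> * (b - a)" "a * (exp \<theta> - 1) < \<theta> * b"
    using exists_chernoff_exponent[of a b] \<open>a < b\<close> by auto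
  then have "0 < \<theta>" using \<open>a < b\<close> by (simp add: zero_less_mult_iff)
  then show ?thesis
    using AE_grid_count_deviation[OF \<Lambda> bound \<theta>(2)] by simp
qed

lemma AE_grid_count_greater:
  fixes \<Lambda> u :: "nat \<Rightarrow> real"
  assumes \<Lambda>: "\<And>k. (\<lambda>n. real n * measure (distr M borel (X (1 / real n))) {u k<..}) \<longlonglongrightarrow> \<Lambda> k"
    and bound: "\<And>k. \<bar>\<Lambda> k - a * real k\<bar> \<le> C" and "b < a"
  shows "AE \<omega> in M. \<forall>\<^sub>F k in sequentially. \<not> (\<forall>\<^sub>F n in sequentially.
           real (card (grid_increments_above (\<lambda>t. X t \<omega>) n (u k))) \<le> b * real k)"
proof -
  obtain \<theta> where \<theta>: "0 < \<theta> * (b - a)" "a * (exp \<theta> - 1) < \<theta> * b"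
    using exists_chernoff_exponent[of a b] \<open>b < a\<close> by auto
  then have "\<theta> < 0" using \<open>b < a\<close> by (simp add: zero_less_mult_iff)
  then show ?thesis
    using AE_grid_count_deviation[OF \<Lambda> bound \<theta>(2)] by (simp add: mult_le_cancel_left)
qed

end

section \<open>From grid counts back to jump counts\<close>

text \<open>Any finite set of b or more jumps would be seen by all fine grids. Since an infinite set
  contains finite subsets of every size, this bounds the count and proves finiteness
  together.\<close>

lemma cadlag_card_jumps_above_less:
  assumes x: "cadlag x"
    and b: "\<not> (\<forall>\<^sub>F n in sequentially. b \<le> real (card (grid_increments_above x n u)))"
  shows "finite (jumps_above x u)" and "real (card (jumps_above x u)) < b"
proof -
  have less: "real (card T) < b" if "finite T" "T \<subseteq> jumps_above x u" for T
  proof (rule ccontr)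
    assume "\<not> real (card T) < b"
    then have "\<forall>\<^sub>F n in sequentially. b \<le> real (card (grid_increments_above x n u))"
      using card_le_grid_increments_above[OF x that] by (auto elim!: eventually_mono)
    then show False using b by contradiction
  qed
  show fin: "finite (jumps_above x u)"
  proof (rule ccontr)
    assume "infinite (jumps_above x u)"
    then obtain T where "finite T" "card T = nat \<lceil>b\<rceil>" "T \<subseteq> jumps_above x u"
      using infinite_arbitrarily_large by blast
    then show False using less[of T] by linarith
  qed
  show "real (card (jumps_above x u)) < b"
    using less[OF fin] by simp
qed

lemma cadlag_card_jumps_above_greater:
  assumes x: "cadlag x" and u: "0 \<le> u" "u < v" and fin: "finite (jumps_above x u)"
    and b: "\<not> (\<forall>\<^sub>F n in sequentially. real (card (grid_increments_above x n v)) \<le> b)"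
  shows "b < real (card (jumps_above x u))"
proof (rule ccontr)
  assume "\<not> b < real (card (jumps_above x u))"
  then have "\<forall>\<^sub>F n in sequentially. real (card (grid_increments_above x n v)) \<le> b"
    using grid_increments_above_le_card[OF x u fin] by (auto elim!: eventually_mono)
  then show False using b by contradiction
qed

lemma jumps_above_antimono: "u \<le> v \<Longrightarrow> jumps_above x v \<subseteq> jumps_above x u"
  by (auto simp: jumps_above_def)

text \<open>The tolerances 1/(m+1) form a countable family, so that the almost sure deviation bounds
  can later be imposed for all m simultaneously. Finiteness is first known only for large k and
  descends to smaller k because the levels decrease.\<close>

lemma cadlag_card_jumps_above_asymptotics:
  fixes u v :: "nat \<Rightarrow> real"
  assumes x: "cadlag x" and uv: "\<And>k. 0 \<le> u k" "\<And>k. u k < v k" and "antimono u"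
    and upper: "\<And>m. \<forall>\<^sub>F k in sequentially. \<not> (\<forall>\<^sub>F n in sequentially.
          (a + 1 / real (Suc m)) * real k \<le> real (card (grid_increments_above x n (u k))))"
    and lower: "\<And>m. \<forall>\<^sub>F k in sequentially. \<not> (\<forall>\<^sub>F n in sequentially.
          real (card (grid_increments_above x n (v k))) \<le> (a - 1 / real (Suc m)) * real k)"
  shows "finite (jumps_above x (u k))"
    and "(\<lambda>k. real (card (jumps_above x (u k))) / real k) \<longlonglongrightarrow> a"
proof -
  have fin: "finite (jumps_above x (u k))" for k
  proof -
    have "\<forall>\<^sub>F k in sequentially. finite (jumps_above x (u k))"
      using upper[of 0] by eventually_elim (rule cadlag_card_jumps_above_less(1)[OF x])
    then obtain l where "k \<le> l" "finite (jumps_above x (u l))"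
      unfolding eventually_sequentially by (meson nle_le order_refl)
    moreover have "jumps_above x (u k) \<subseteq> jumps_above x (u l)"
      using \<open>antimono u\<close> \<open>k \<le> l\<close> by (intro jumps_above_antimono) (simp add: antimono_def)
    ultimately show ?thesis by (rule_tac finite_subset)
  qed
  then show "finite (jumps_above x (u k))" .
  show "(\<lambda>k. real (card (jumps_above x (u k))) / real k) \<longlonglongrightarrow> a"
  proof (rule LIMSEQ_I)
    fix r :: real assume "0 < r"
    then obtain m where m: "1 / real (Suc m) < r"
      using nat_approx_posE by metis
    have "\<forall>\<^sub>F k in sequentially. norm (real (card (jumps_above x (u k))) / real k - a) < r"
      using upper[of m] lower[of m] eventually_gt_at_top[of 0]
    proof eventually_elim
      case (elim k)
      have "real (card (jumps_above x (u k))) < (a + 1 / real (Suc m)) * real k"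
        by (rule cadlag_card_jumps_above_less(2)[OF x elim(1)])
      moreover have "(a - 1 / real (Suc m)) * real k < real (card (jumps_above x (u k)))"
        by (rule cadlag_card_jumps_above_greater[OF x uv fin elim(2)])
      ultimately have "real (card (jumps_above x (u k))) / real k < a + 1 / real (Suc m)"
          "a - 1 / real (Suc m) < real (card (jumps_above x (u k))) / real k"
        using elim(3) by (simp_all add: pos_divide_less_eq pos_less_divide_eq del: of_nat_Suc)
      then show ?case using m by (simp add: abs_less_iff del: of_nat_Suc)
    qed
    then show "\<exists>no. \<forall>k\<ge>no. norm (real (card (jumps_above x (u k))) / real k - a) < r"
      by (simp add: eventually_sequentially)
  qed
qed

section \<open>Jump counts of the tempered stable process\<close>

context TS_process
begin

lemma char_X_inverse_nat:
  assumes params: "0 < \<alpha>" "0 < lam" "0 < \<beta>" "\<beta> < 1" and n: "0 < n"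
  shows "char (distr M borel (X (1 / real n))) z
    = exp ((CLINT x|TS_levy_measure \<alpha> \<beta> lam. iexp (z * x) - 1) / of_nat n)"
proof (rule nth_root_exp_unique)
  interpret D: real_distribution "distr M borel (X (1 / real n))"
    using measurable_X[of "1 / real n"] by (rule_tac real_distribution_distr) simp
  show "continuous_on UNIV (char (distr M borel (X (1 / real n))))"
    by (intro continuous_at_imp_continuous_on ballI D.isCont_char)
  show "char (distr M borel (X (1 / real n))) 0 = 1" by (rule D.char_zero)
  show "continuous_on UNIV (\<lambda>z. CLINT x|TS_levy_measure \<alpha> \<beta> lam. iexp (z * x) - 1)"
    using params by (intro continuous_on_levy_exponent sets_TS_levy_measure integrable_TS_levy_measure)
  show "char (distr M borel (X (1 / real n))) z ^ n
      = exp (CLINT x|TS_levy_measure \<alpha> \<beta> lam. iexp (z * x) - 1)" for z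
    using distr_X_1 char_X_1_eq_power[OF n, of z] by (simp add: TS_distribution_def)
qed (use n in simp_all)

text \<open>The neighbouring levels \<open>phi \<beta> (k + 1)\<close> and
  \<open>phi \<beta> k\<close> supply the strict gap u < v of the path comparison; both have tail
  mass \<alpha> k + O(1), so the gap does not affect the limit.\<close>

lemma AE_card_jumps_above_phi:
  assumes params: "0 < \<alpha>" "0 < lam" "0 < \<beta>" "\<beta> < 1"
  shows "AE \<omega> in M. (\<forall>k. finite (jumps_above (\<lambda>t. X t \<omega>) (phi \<beta> (real (k + 1))))) \<and>
    (\<lambda>k. real (card (jumps_above (\<lambda>t. X t \<omega>) (phi \<beta> (real (k + 1))))) / real k) \<longlonglongrightarrow> \<alpha>"
proof -
  let ?F = "TS_levy_measure \<alpha> \<beta> lam"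
  \<comment> \<open>The last summand \<alpha> accounts for the shift from k to k + 1 in the second
    bound.\<close>
  define C where "C = \<alpha> / \<beta> + \<alpha> * lam / (1 - \<beta>) + \<alpha>"
  have tail: "(\<lambda>n. real n * measure (distr M borel (X (1 / real n))) {u<..}) \<longlonglongrightarrow> measure ?F {u<..}" if "0 < u" for u
  proof (rule tail_tendsto_levy_measure)
    show "real_distribution (distr M borel (X (1 / real n)))" for n
      using measurable_X[of "1 / real n"] by (rule_tac real_distribution_distr) simp
  qed (use params that char_X_inverse_nat in \<open>simp_all add: sigma_finite_TS_levy_measure
        sets_TS_levy_measure integrable_TS_levy_measure emeasure_TS_levy_measure_singleton\<close>)
  have bound: "\<bar>measure ?F {phi \<beta> (real k)<..} - \<alpha> * real k\<bar> \<le> C"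
      "\<bar>measure ?F {phi \<beta> (real (k + 1))<..} - \<alpha> * real k\<bar> \<le> C" for k
    using TS_levy_measure_tail_phi[OF params, of "real k"] TS_levy_measure_tail_phi[OF params, of "real (k + 1)"]
      params(1) by (auto simp: C_def abs_le_iff algebra_simps)
  have pos: "0 < phi \<beta> (real k)" for k using params by (simp add: phi_pos)
  have "AE \<omega> in M. \<forall>m. \<forall>\<^sub>F k in sequentially. \<not> (\<forall>\<^sub>F n in sequentially.
      (\<alpha> + 1 / real (Suc m)) * real k \<le> real (card (grid_increments_above (\<lambda>t. X t \<omega>) n (phi \<beta> (real (k + 1))))))"
    by (intro AE_all_countable[THEN iffD2] allI AE_grid_count_less[OF tail[OF pos] bound(2)]) simp
  moreover have "AE \<omega> in M. \<forall>m. \<forall>\<^sub>F k in sequentially. \<not> (\<forall>\<^sub>F n in sequentially.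
      real (card (grid_increments_above (\<lambda>t. X t \<omega>) n (phi \<beta> (real k)))) \<le> (\<alpha> - 1 / real (Suc m)) * real k)"
    by (intro AE_all_countable[THEN iffD2] allI AE_grid_count_greater[OF tail[OF pos] bound(1)]) simp
  ultimately show ?thesis
    using cadlag_paths
  proof eventually_elim
    case (elim \<omega>)
    have "antimono (\<lambda>k. phi \<beta> (real (k + 1)))"
      using params by (intro decseq_SucI less_imp_le phi_strict_antimono) auto
    moreover have "phi \<beta> (real (k + 1)) < phi \<beta> (real k)" for k
      using params by (intro phi_strict_antimono) auto
    ultimately show ?case
      using cadlag_card_jumps_above_asymptotics[where u="\<lambda>k. phi \<beta> (real (k + 1))" and v="\<lambda>k. phi \<beta> (real k)" and a=\<alpha>,
          OF elim(3) less_imp_le[OF pos] _ _ elim(1)[rule_format] elim(2)[rule_format]] by blast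
  qed
qed

end

section \<open>Telescoping the sums of jump counts\<close>

text \<open>Since u >= 0, every jump above u is nonzero, as \<open>jump_measure\<close> requires;
  finiteness turns the counting measure into a cardinality and permits the subtraction.\<close>

lemma jump_measure_eq_card_diff:
  assumes fin: "finite (jumps_above (\<lambda>t. X t \<omega>) u)" and "0 \<le> u" "u \<le> v"
  shows "jump_measure X ({0<..1} \<times> {u<..v}) \<omega> =
    ennreal (real (card (jumps_above (\<lambda>t. X t \<omega>) u)) - real (card (jumps_above (\<lambda>t. X t \<omega>) v)))"
proof -
  let ?J = "jumps_above (\<lambda>t. X t \<omega>)"
  have sub: "?J v \<subseteq> ?J u" using \<open>u \<le> v\<close> by (rule jumps_above_antimono)
  have "{t. 0 < t \<and> jump (\<lambda>s. X s \<omega>) t \<noteq> 0 \<and> (t, jump (\<lambda>s. X s \<omega>) t) \<in> {0<..1} \<times> {u<..v}} = ?J u - ?J v"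
    using \<open>0 \<le> u\<close> by (auto simp: jumps_above_def)
  then have "jump_measure X ({0<..1} \<times> {u<..v}) \<omega> = of_nat (card (?J u - ?J v))"
    using fin by (simp add: jump_measure_def)
  also have "\<dots> = ennreal (real (card (?J u) - card (?J v)))"
    using fin sub by (simp add: card_Diff_subset finite_subset ennreal_of_nat_eq_real_of_nat)
  also have "real (card (?J u) - card (?J v)) = real (card (?J u)) - real (card (?J v))"
    using fin sub by (intro of_nat_diff card_mono)
  finally show ?thesis .
qed

theorem proposition5p6:
  fixes M :: "'a measure" and X :: "real \<Rightarrow> 'a \<Rightarrow> real"
    and \<alpha> \<beta> lam :: real and Y :: "nat \<Rightarrow> 'a \<Rightarrow> ennreal"
  assumes "0 < \<alpha>" and "0 < lam" and "0 < \<beta>" and "\<beta> < 1"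
    and "TS_process M X \<alpha> \<beta> lam"
    and Y_def: "\<And>n \<omega>. Y n \<omega> =
          jump_measure X ({0<..1} \<times> {phi \<beta> (real (n + 1))<..phi \<beta> (real n)}) \<omega>"
  shows "AE \<omega> in M. (\<lambda>n. (\<Sum>j=1..n. Y j \<omega>) / of_nat n) \<longlonglongrightarrow> ennreal \<alpha>"
proof -
  interpret TS_process M X \<alpha> \<beta> lam by fact
  show ?thesis
    using AE_card_jumps_above_phi[OF assms(1-4)]
  proof eventually_elim
    case (elim \<omega>)
    \<comment> \<open>With this shift the j-th count is the number of elements gained from
      \<open>J (j - 1)\<close> to \<open>J j\<close>, so the sum from j = 1 telescopes down to the
      fixed finite set \<open>J 0\<close>, whose contribution vanishes after division by n.\<close>
    define J where "J k = jumps_above (\<lambda>t. X t \<omega>) (phi \<beta> (real (k + 1)))" for k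
    have fin: "finite (J k)" for k using elim by (simp add: J_def)
    have lim: "(\<lambda>k. real (card (J k)) / real k) \<longlonglongrightarrow> \<alpha>" using elim by (simp add: J_def)
    have anti: "phi \<beta> (real (k + 1)) \<le> phi \<beta> (real k)" for k
      using assms by (intro less_imp_le[OF phi_strict_antimono]) auto
    have mono: "card (J k) \<le> card (J (Suc k))" for k
      using fin[of "Suc k"] anti[of "k + 1"] unfolding J_def by (intro card_mono jumps_above_antimono) simp_all
    have Y: "Y (Suc k) \<omega> = ennreal (real (card (J (Suc k))) - real (card (J k)))" for k
      unfolding Y_def J_def using fin[of "Suc k"] anti[of "Suc k"] phi_pos[of \<beta> "real (Suc k + 1)"] assms(3)
      by (subst jump_measure_eq_card_diff) (auto simp: J_def)
    have sum: "(\<Sum>j=1..n. Y j \<omega>) = ennreal (real (card (J n)) - real (card (J 0)))" for n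
    proof -
      have "(\<Sum>j=1..n. Y j \<omega>) = (\<Sum>k<n. Y (Suc k) \<omega>)"
        by (simp add: sum.atLeast1_atMost_eq)
      \<comment> \<open>The telescoping is carried out in the reals, where subtraction is not
        truncated; \<open>mono\<close> gives the nonnegative terms needed to move the sum inside
        \<open>ennreal\<close>.\<close>
      also have "\<dots> = ennreal (\<Sum>k<n. real (card (J (Suc k))) - real (card (J k)))"
        unfolding Y using mono by (intro sum_ennreal) simp
      also have "\<dots> = ennreal (real (card (J n)) - real (card (J 0)))"
        using sum_lessThan_telescope[of "\<lambda>k. real (card (J k))" n] by simp
      finally show ?thesis .
    qed
    have "(\<lambda>n. real (card (J n)) / real n - real (card (J 0)) / real n) \<longlonglongrightarrow> \<alpha> - 0"
      by (intro tendsto_diff lim lim_const_over_n)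
    then have "(\<lambda>n. ennreal (real (card (J n)) / real n - real (card (J 0)) / real n)) \<longlonglongrightarrow> ennreal \<alpha>"
      by (intro tendsto_ennrealI) simp
    then show "(\<lambda>n. (\<Sum>j=1..n. Y j \<omega>) / of_nat n) \<longlonglongrightarrow> ennreal \<alpha>"
    proof (rule Lim_transform_eventually)
      show "\<forall>\<^sub>F n in sequentially. ennreal (real (card (J n)) / real n - real (card (J 0)) / real n)
          = (\<Sum>j=1..n. Y j \<omega>) / of_nat n"
        using eventually_gt_at_top[of 0]
      proof eventually_elim
        case (elim n)
        have "card (J 0) \<le> card (J n)" using lift_Suc_mono_le[of "\<lambda>k. card (J k)"] mono by simp
        then show ?case unfolding sum
          using elim by (simp add: ennreal_of_nat_eq_real_of_nat divide_ennreal diff_divide_distrib)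
      qed
    qed
  qed
qed

end
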